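(* For every integer $n\ge 2$ there exists $\delta>0$ (depending on $n$) such that for every $\beta\in[0,1]$ with $1-\beta<\delta$ we have $r_n(\beta)\le 1-\frac{3}{10}\beta(1-\beta)$.
   Context: For $\beta\in[0,1]$, let $S(\beta)$ be the set of polynomials of degree at least $2$ with complex coefficients, with all roots in the closed unit disk $\{z\in\mathbb{C}: |z|\le 1\}$, and with at least one root at $\beta$. For $P\in S(\beta)$, let $d(P,\beta)$ be the distance between $\beta$ and the closest root of the derivative $P'$, i.e. $d(P,\beta)=\min\{|\zeta-\beta| : P'(\zeta)=0\}$. For an integer $n\ge 2$, let $r_n(\beta)=\sup\{d(P,\beta) : P\in S(\beta),\ \deg P=n\}$. *)

theory Defs
  imports
    "HOL-Analysis.Analysis"
    "HOL-Computational_Algebra.Fundamental_Theorem_Algebra"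
begin

definition disk_polys :: "real \<Rightarrow> complex poly set" where
  "disk_polys \<beta> = {P. degree P \<ge> 2 \<and> (\<forall>z. poly P z = 0 \<longrightarrow> cmod z \<le> 1)
     \<and> poly P (complex_of_real \<beta>) = 0}"

definition crit_dist :: "complex poly \<Rightarrow> real \<Rightarrow> real" where
  "crit_dist P \<beta> = Min {cmod (\<zeta> - complex_of_real \<beta>) | \<zeta>. poly (pderiv P) \<zeta> = 0}"

definition sendov_r :: "nat \<Rightarrow> real \<Rightarrow> real" where
  "sendov_r n \<beta> = Sup {crit_dist P \<beta> | P. P \<in> disk_polys \<beta> \<and> degree P = n}"

text \<open>\<^const>\<open>Min\<close> needs a finite nonempty set and the real \<^const>\<open>Sup\<close> a nonempty
  set bounded above; the following facts show that this is so here for \<open>n \<ge> 2\<close> and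
  \<open>\<beta> \<in> {0..1}\<close>. Boundedness comes from Gauss--Lucas for the unit disk.\<close>

lemma crit_dist_set:
  assumes "P \<in> disk_polys \<beta>"
  shows "finite {cmod (\<zeta> - complex_of_real \<beta>) | \<zeta>. poly (pderiv P) \<zeta> = 0}"
    and "{cmod (\<zeta> - complex_of_real \<beta>) | \<zeta>. poly (pderiv P) \<zeta> = 0} \<noteq> {}"
proof -
  have d: "degree (pderiv P) \<ge> 1"
    using assms by (auto simp: disk_polys_def degree_pderiv)
  hence "pderiv P \<noteq> 0" by auto
  hence "finite {\<zeta>. poly (pderiv P) \<zeta> = 0}" by (rule poly_roots_finite)
  thus "finite {cmod (\<zeta> - complex_of_real \<beta>) | \<zeta>. poly (pderiv P) \<zeta> = 0}"
    by (simp add: setcompr_eq_image)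
  have "\<not> constant (poly (pderiv P))" using d by (simp add: constant_degree)
  then obtain \<zeta> where "poly (pderiv P) \<zeta> = 0"
    using fundamental_theorem_of_algebra by blast
  thus "{cmod (\<zeta> - complex_of_real \<beta>) | \<zeta>. poly (pderiv P) \<zeta> = 0} \<noteq> {}" by auto
qed

lemma sendov_r_set_nonempty:
  assumes "n \<ge> 2" "\<beta> \<in> {0..1}"
  shows "{crit_dist P \<beta> | P. P \<in> disk_polys \<beta> \<and> degree P = n} \<noteq> {}"
proof -
  have "[:- complex_of_real \<beta>, 1:] ^ n \<in> disk_polys \<beta>"
    using assms by (auto simp: disk_polys_def degree_linear_power poly_power)
  moreover have "degree ([:- complex_of_real \<beta>, 1:] ^ n) = n"
    by (simp add: degree_linear_power)
  ultimately show ?thesis by blast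
qed

lemma pderiv_linear_prod:
  fixes A :: "complex multiset"
  assumes "\<And>a. a \<in># A \<Longrightarrow> cmod a \<le> 1" "cmod z > 1"
  shows "poly (\<Prod>a\<in>#A. [:-a, 1:]) z \<noteq> 0 \<and>
    poly (pderiv (\<Prod>a\<in>#A. [:-a, 1:])) z = poly (\<Prod>a\<in>#A. [:-a, 1:]) z * (\<Sum>a\<in>#A. 1 / (z - a))"
  using assms(1)
proof (induction A)
  case (add a A)
  from add.prems have "cmod a \<le> 1" by simp
  hence za: "z - a \<noteq> 0" using assms(2) by auto
  define Q where "Q = (\<Prod>a\<in>#A. [:-a, 1:])"
  define S where "S = (\<Sum>a\<in>#A. 1 / (z - a))"
  have IH: "poly Q z \<noteq> 0" "poly (pderiv Q) z = poly Q z * S"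
    unfolding Q_def S_def using add by simp_all
  have "poly (pderiv ([:-a, 1:] * Q)) z = poly Q z + (z - a) * poly (pderiv Q) z"
    by (simp only: pderiv_mult poly_add poly_mult) (simp add: pderiv_pCons algebra_simps)
  also have "\<dots> = (z - a) * poly Q z * (1 / (z - a) + S)"
    using za unfolding IH(2) by (simp add: distrib_left mult.assoc)
  finally have "poly (pderiv ([:-a, 1:] * Q)) z = poly ([:-a, 1:] * Q) z * (1 / (z - a) + S)"
    by (simp add: algebra_simps)
  moreover have "poly ([:-a, 1:] * Q) z \<noteq> 0"
    using za IH(1) by (simp only: poly_mult) simp
  ultimately show ?case
    by (simp only: image_mset_add_mset prod_mset.add_mset sum_mset.add_mset Q_def S_def) simp
qed simp

lemma pderiv_root_in_disk:
  assumes "P \<in> disk_polys \<beta>" "poly (pderiv P) z = 0"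
  shows "cmod z \<le> 1"
proof (rule ccontr)
  assume "\<not> cmod z \<le> 1"
  hence z: "cmod z > 1" by simp
  have deg: "degree P \<ge> 2" and rts: "\<And>w. poly P w = 0 \<Longrightarrow> cmod w \<le> 1"
    using assms(1) by (auto simp: disk_polys_def)
  obtain A where A: "smult (lead_coeff P) (\<Prod>a\<in>#A. [:-a, 1:]) = P" "size A = degree P"
  proof -
    have "P \<noteq> 0" using deg by auto
    thus ?thesis using alg_closed_imp_factorization[of P] that by metis
  qed
  have P0: "lead_coeff P \<noteq> 0" using deg by auto
  have A1: "cmod a \<le> 1" if "a \<in># A" for a
  proof -
    have "[:-a, 1:] dvd (\<Prod>a\<in>#A. [:-a, 1:])"
      using that by (intro dvd_prod_mset) auto
    hence "poly (\<Prod>a\<in>#A. [:-a, 1:]) a = 0" by (simp add: poly_eq_0_iff_dvd)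
    hence "poly P a = 0" by (subst A(1) [symmetric]) simp
    thus ?thesis by (rule rts)
  qed
  have "lead_coeff P * poly (pderiv (\<Prod>a\<in>#A. [:-a, 1:])) z = 0"
    using assms(2) by (metis A(1) pderiv_smult poly_smult)
  hence "poly (pderiv (\<Prod>a\<in>#A. [:-a, 1:])) z = 0" using P0 by simp
  with pderiv_linear_prod[of A z, OF A1 z] have s0: "(\<Sum>a\<in>#A. 1 / (z - a)) = 0" by auto
  have pos: "Re (z * (1 / (z - a))) > 0" if "a \<in># A" for a
  proof -
    have "Re (cnj z * a) \<le> cmod z * cmod a"
      by (metis complex_Re_le_cmod complex_mod_cnj norm_mult)
    also have "\<dots> \<le> cmod z" using A1[OF that] z by (simp add: mult_left_le)
    also have "\<dots> < (cmod z)\<^sup>2" unfolding power2_eq_square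
      using mult_strict_left_mono[OF z, of "cmod z"] z by linarith
    finally have "Re (z * cnj (z - a)) > 0"
      unfolding cmod_power2 by (simp add: cmod_power2 power2_eq_square algebra_simps)
    moreover have "z \<noteq> a" using A1[OF that] z by auto
    ultimately show ?thesis
      by (simp add: Re_complex_div_gt_0)
  qed
  have "Re (\<Sum>a\<in>#B. z * (1 / (z - a))) > 0" if "B \<subseteq># A" "B \<noteq> {#}" for B
    using that
  proof (induction B)
    case (add b B)
    have "b \<in># A" using add.prems(1) by (meson mset_subset_eqD union_single_eq_member)
    moreover have "B \<subseteq># A" using add.prems(1) by (meson mset_subset_eq_insertD subset_mset.less_imp_le)
    ultimately show ?case using pos[of b] add.IH by (cases "B = {#}") auto
  qed simp
  moreover have "A \<noteq> {#}" using A(2) deg by auto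
  ultimately have "Re (\<Sum>a\<in>#A. z * (1 / (z - a))) > 0" by simp
  moreover have "(\<Sum>a\<in>#A. z * (1 / (z - a))) = z * (\<Sum>a\<in>#A. 1 / (z - a))"
    by (simp only: sum_mset_distrib_left)
  ultimately show False using s0 by simp
qed

lemma sendov_r_set_bdd_above:
  assumes "\<beta> \<in> {0..1}"
  shows "bdd_above {crit_dist P \<beta> | P. P \<in> disk_polys \<beta> \<and> degree P = n}"
proof (rule bdd_aboveI[of _ 2])
  fix x assume "x \<in> {crit_dist P \<beta> | P. P \<in> disk_polys \<beta> \<and> degree P = n}"
  then obtain P where P: "P \<in> disk_polys \<beta>" "x = crit_dist P \<beta>" by auto
  have "x \<in> {cmod (\<zeta> - complex_of_real \<beta>) | \<zeta>. poly (pderiv P) \<zeta> = 0}"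
    unfolding P(2) crit_dist_def using crit_dist_set[OF P(1)] by (rule Min_in)
  then obtain \<zeta> where "x = cmod (\<zeta> - complex_of_real \<beta>)" "poly (pderiv P) \<zeta> = 0" by auto
  moreover from this have "cmod \<zeta> \<le> 1" using pderiv_root_in_disk[OF P(1)] by blast
  ultimately show "x \<le> 2"
    using assms norm_triangle_ineq4[of \<zeta> "complex_of_real \<beta>"] by simp
qed

end

theory Submission
  imports Defs
begin

text \<open>
  Suppose that polynomials \<open>P\<close> of degree \<open>n\<close> violate the bound for values of \<open>\<beta>\<close> tending to 1, that is, all
  critical points of \<open>P\<close> have distance more than \<open>r = 1 - 3/10 \<beta> (1 - \<beta>)\<close> from \<open>\<beta>\<close>. At \<open>\<beta> = 1\<close> this is
  impossible, because \<open>P''(\<beta>) / P'(\<beta>)\<close> is on the one hand the sum of the \<open>1 / (\<beta> - \<zeta>)\<close> over the critical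
  points \<open>\<zeta>\<close>, and on the other hand twice the sum of the \<open>1 / (\<beta> - z)\<close> over the other roots \<open>z\<close>; the
  borderline case is \<open>z^n - 1\<close>. For \<open>\<beta>\<close> near 1 the same identity shows that \<open>P\<close> is close to
  \<open>z^n - 1\<close>: the real parts of the critical points are of order \<open>1 - \<beta>\<close> and the imaginary parts of order
  \<open>sqrt (1 - \<beta>)\<close> (lemma \<open>far_critical_points_small\<close>).

  After rescaling and passing to a subsequence the critical points converge. Write
  \<open>P = z^n - 1 + Q\<close>. At a root of \<open>P\<close> in the unit disk \<open>Re Q \<ge> 0\<close>, and near each \<open>n\<close>-th root of unity there
  is such a root. Hence every \<open>n\<close>-th root of unity gives a linear inequality for three numbers: the
  limits \<open>a\<close> and \<open>B\<close> of the rescaled real and imaginary parts of the sum of the critical points, and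
  the limit \<open>S\<close> of the rescaled sum of squares of their imaginary parts (lemma
  \<open>first_order_condition\<close>). The distance condition bounds \<open>a\<close> from above in terms of \<open>S\<close>. For
  \<open>n \<ge> 3\<close> other than 5, the inequalities at two suitable roots of unity, whose angles enclose one near
  \<open>2 * pi / 3\<close>, are then inconsistent (lemma \<open>degree_5\<close>). Degree 2 is elementary.

  For \<open>n = 5\<close> the constant \<open>3/10\<close> is exactly the borderline: the first order inequalities have one
  solution, in which all of them are equalities (lemma \<open>quintic_rigid\<close>). The decision falls at
  second order in \<open>1 - \<beta>\<close>. The combination of the inequalities that degenerates is the linearization of
  an exact one, \<open>3 ln |z| + Re (1 / z - z) \<le> 0\<close> for \<open>1/2 \<le> |z| \<le> 1\<close>, whose sum over the roots is a function of
  the coefficients of \<open>P\<close>. Its expansion to second order has a positive value, which is a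
  contradiction (lemmas \<open>quintic_expansion\<close> and \<open>not_quintic\<close>). It is here that the factor \<open>\<beta>\<close> in the bound
  matters: the term \<open>3/10 (1 - \<beta>)^2\<close> contributes 6 to a value of at least \<open>23/10\<close>.
\<close>

section \<open>Polynomials given by their roots\<close>

definition root_prod :: "nat \<Rightarrow> (nat \<Rightarrow> complex) \<Rightarrow> complex poly" where
  "root_prod N a = (\<Prod>i<N. [:- a i, 1:])"

lemma root_prod_0 [simp]: "root_prod 0 a = 1"
  by (simp add: root_prod_def)

lemma root_prod_Suc: "root_prod (Suc N) a = [:- a N, 1:] * root_prod N a"
  by (simp add: root_prod_def mult.commute)

lemma poly_root_prod: "poly (root_prod N a) w = (\<Prod>i<N. w - a i)"
  by (simp add: root_prod_def poly_prod)

lemma root_prod_nonzero [simp]: "root_prod N a \<noteq> 0"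
  by (simp add: root_prod_def)

lemma degree_root_prod [simp]: "degree (root_prod N a) = N"
  by (simp add: root_prod_def degree_prod_eq_sum_degree)

lemma lead_coeff_root_prod [simp]: "coeff (root_prod N a) N = 1"
proof -
  have "lead_coeff (root_prod N a) = 1"
    by (simp add: root_prod_def lead_coeff_prod)
  then show ?thesis by simp
qed

lemma poly_pderiv_root_prod:
  assumes "\<And>i. i < N \<Longrightarrow> w \<noteq> a i"
  shows "poly (pderiv (root_prod N a)) w = poly (root_prod N a) w * (\<Sum>i<N. 1 / (w - a i))"
  using assms
proof (induction N)
  case (Suc N)
  have IH: "poly (pderiv (root_prod N a)) w = poly (root_prod N a) w * (\<Sum>i<N. 1 / (w - a i))"
    using Suc by simp
  have w: "w - a N \<noteq> 0" using Suc.prems[of N] by simp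
  have "poly (pderiv (root_prod (Suc N) a)) w
      = poly (root_prod N a) w + (w - a N) * poly (pderiv (root_prod N a)) w"
    unfolding root_prod_Suc pderiv_mult poly_add poly_mult by (simp add: pderiv_pCons)
  also have "\<dots> = (w - a N) * poly (root_prod N a) w * ((\<Sum>i<N. 1 / (w - a i)) + 1 / (w - a N))"
    unfolding IH using w by (simp add: distrib_left)
  also have "\<dots> = poly (root_prod (Suc N) a) w * (\<Sum>i<Suc N. 1 / (w - a i))"
    by (simp add: poly_root_prod)
  finally show ?case .
qed simp

lemma coeff_root_prod_Suc:
  "coeff (root_prod (Suc N) a) (Suc i) = coeff (root_prod N a) i - a N * coeff (root_prod N a) (Suc i)"
  "coeff (root_prod (Suc N) a) 0 = - a N * coeff (root_prod N a) 0"
  by (simp_all add: root_prod_Suc)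

lemma coeff_root_prod_e1: "coeff (root_prod (Suc N) a) N = - (\<Sum>i<Suc N. a i)"
proof (induction N)
  case 0
  then show ?case by (simp add: coeff_root_prod_Suc)
next
  case (Suc N)
  then show ?case by (subst coeff_root_prod_Suc) simp
qed

text \<open>
  Newton's identity for the second elementary symmetric function. In the limit the critical
  points are purely imaginary with vanishing sum, and then only the sum of squares survives.
\<close>

lemma coeff_root_prod_e2:
  "2 * coeff (root_prod (Suc (Suc N)) a) N
    = (\<Sum>i<Suc (Suc N). a i)\<^sup>2 - (\<Sum>i<Suc (Suc N). (a i)\<^sup>2)"
proof (induction N)
  case 0
  then show ?case by (simp add: coeff_root_prod_Suc power2_eq_square algebra_simps)
next
  case (Suc N)
  have "2 * coeff (root_prod (Suc (Suc (Suc N))) a) (Suc N)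
     = 2 * coeff (root_prod (Suc (Suc N)) a) N - 2 * a (Suc (Suc N)) * coeff (root_prod (Suc (Suc N)) a) (Suc N)"
    by (subst coeff_root_prod_Suc) (simp add: algebra_simps)
  also have "\<dots> = (\<Sum>i<Suc (Suc (Suc N)). a i)\<^sup>2 - (\<Sum>i<Suc (Suc (Suc N)). (a i)\<^sup>2)"
    unfolding Suc.IH coeff_root_prod_e1 sum.lessThan_Suc[of _ "Suc (Suc N)"]
    by (simp add: power2_eq_square algebra_simps)
  finally show ?case .
qed

lemma ex_root_prod:
  assumes "P \<noteq> (0 :: complex poly)"
  shows "\<exists>a. P = smult (lead_coeff P) (root_prod (degree P) a)"
proof -
  obtain A where A: "size A = degree P" "P = smult (lead_coeff P) (\<Prod>x\<in>#A. [:- x, 1:])"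
    using alg_closed_imp_factorization[OF assms] by metis
  obtain xs where xs: "mset xs = A" using ex_mset by blast
  have "(\<Prod>x\<in>#A. [:- x, 1:]) = prod_list (map (\<lambda>x. [:- x, 1:]) xs)"
    by (simp flip: xs mset_map add: prod_mset_prod_list)
  also have "\<dots> = root_prod (length xs) (\<lambda>i. xs ! i)"
    by (simp add: root_prod_def prod.list_conv_set_nth atLeast0LessThan)
  finally show ?thesis using A xs by (metis size_mset)
qed

text \<open>
  A polynomial is the integral of its derivative; this recovers \<open>P\<close> from its critical points
  and one prescribed root.
\<close>

lemma poly_diff_eq_sum_pderiv:
  fixes P :: "complex poly"
  shows "poly P w - poly P b
    = (\<Sum>k<degree P. coeff (pderiv P) k / of_nat (Suc k) * (w ^ Suc k - b ^ Suc k))"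
proof -
  have *: "poly P w = coeff P 0 + (\<Sum>k<degree P. coeff P (Suc k) * w ^ Suc k)" for w
    unfolding poly_altdef by (simp add: sum.atMost_shift)
  show ?thesis unfolding * coeff_pderiv
    by (simp add: sum_subtractf[symmetric] right_diff_distrib del: power_Suc of_nat_Suc)
qed

section \<open>Polynomials whose critical points are all far from the root\<close>

text \<open>
  The number \<open>N\<close> is the degree of \<open>P\<close> minus one, so the roots of \<open>P\<close> are \<open>\<beta>\<close> and \<open>z 0, \<dots>, z (N - 1)\<close>,
  and the critical points are \<open>\<zeta> 0, \<dots>, \<zeta> (N - 1)\<close>, all with multiplicity. The derivative is
  recorded as an identity of polynomials because both the values at \<open>\<beta>\<close> and single coefficients
  of it are used.
\<close>

definition far_critical :: "nat \<Rightarrow> real \<Rightarrow> (nat \<Rightarrow> complex) \<Rightarrow> (nat \<Rightarrow> complex) \<Rightarrow> bool" where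
  "far_critical N \<beta> z \<zeta> \<longleftrightarrow>
     (\<forall>i<N. cmod (z i) \<le> 1) \<and>
     (\<forall>k<N. 1 - 3 / 10 * \<beta> * (1 - \<beta>) < cmod (\<zeta> k - complex_of_real \<beta>)) \<and>
     pderiv ([:- complex_of_real \<beta>, 1:] * root_prod N z) = smult (of_nat (Suc N)) (root_prod N \<zeta>)"

text \<open>
  A violation of the bound on the supremum is witnessed by one polynomial, which splits over the
  complex numbers together with its derivative; the leading coefficient cancels.
\<close>

lemma far_critical_exists:
  assumes n: "n \<ge> 2" and b: "\<beta> \<in> {0..1}" and gt: "\<not> sendov_r n \<beta> \<le> 1 - 3 / 10 * \<beta> * (1 - \<beta>)"
  shows "\<exists>z \<zeta>. far_critical (n - 1) \<beta> z \<zeta>"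
proof -
  let ?r = "1 - 3 / 10 * \<beta> * (1 - \<beta>)"
  obtain P where P: "P \<in> disk_polys \<beta>" "degree P = n" "?r < crit_dist P \<beta>"
    using gt less_cSupD[OF sendov_r_set_nonempty[OF n b], of ?r] unfolding sendov_r_def by auto
  have crit: "?r < cmod (w - complex_of_real \<beta>)" if "poly (pderiv P) w = 0" for w
  proof -
    have "crit_dist P \<beta> \<le> cmod (w - complex_of_real \<beta>)"
      unfolding crit_dist_def by (rule Min_le[OF crit_dist_set(1)[OF P(1)]]) (use that in auto)
    with P(3) show ?thesis by linarith
  qed
  have P0: "P \<noteq> 0" using P(2) n by auto
  define c where "c = lead_coeff P"
  have c: "c \<noteq> 0" using P0 by (simp add: c_def)
  have "poly P (complex_of_real \<beta>) = 0" using P(1) by (simp add: disk_polys_def)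
  then obtain G where G: "P = [:- complex_of_real \<beta>, 1:] * G"
    by (metis poly_eq_0_iff_dvd dvdE)
  have G0: "G \<noteq> 0" using G P0 by auto
  have "degree P = 1 + degree G" unfolding G by (subst degree_mult_eq) (use G0 in auto)
  then have dG: "degree G = n - 1" using P(2) by simp
  have lG: "lead_coeff G = c" unfolding c_def G lead_coeff_mult by simp
  obtain z where z: "G = smult c (root_prod (n - 1) z)"
    using ex_root_prod[OF G0] unfolding dG lG[unfolded dG] by blast
  have dP': "degree (pderiv P) = n - 1" by (simp add: degree_pderiv P(2))
  have lP': "lead_coeff (pderiv P) = of_nat n * c"
    unfolding dP' c_def P(2) coeff_pderiv using n by simp
  have P'0: "pderiv P \<noteq> 0" using lP' c n by auto
  obtain \<zeta> where \<zeta>: "pderiv P = smult (of_nat n * c) (root_prod (n - 1) \<zeta>)"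
    using ex_root_prod[OF P'0] unfolding dP' lP'[unfolded dP'] by blast
  have Pz: "P = smult c ([:- complex_of_real \<beta>, 1:] * root_prod (n - 1) z)"
    unfolding G z by (rule mult_smult_right)
  have "smult c (pderiv ([:- complex_of_real \<beta>, 1:] * root_prod (n - 1) z))
      = smult c (smult (of_nat n) (root_prod (n - 1) \<zeta>))"
    using \<zeta> unfolding Pz pderiv_smult by (simp add: mult.commute)
  then have "pderiv ([:- complex_of_real \<beta>, 1:] * root_prod (n - 1) z) = smult (of_nat n) (root_prod (n - 1) \<zeta>)"
    by (rule smult_cancel[OF c])
  moreover have "cmod (z i) \<le> 1" if "i < n - 1" for i
  proof -
    have "poly P (z i) = 0" unfolding Pz poly_smult poly_mult poly_root_prod
      using that by auto
    then show ?thesis using P(1) by (simp add: disk_polys_def)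
  qed
  moreover have "?r < cmod (\<zeta> k - complex_of_real \<beta>)" if "k < n - 1" for k
  proof (rule crit)
    show "poly (pderiv P) (\<zeta> k) = 0" unfolding \<zeta> poly_smult poly_root_prod
      using that by auto
  qed
  moreover have "Suc (n - 1) = n" using n by simp
  ultimately have "far_critical (n - 1) \<beta> z \<zeta>" unfolding far_critical_def by simp
  then show ?thesis by blast
qed

section \<open>A priori bounds for the critical points\<close>

text \<open>
  Inversion about \<open>\<beta>\<close> maps the unit disk to the exterior of a disk. For \<open>\<beta> = 1\<close> this is the half
  plane \<open>Re w \<ge> 1 / 2\<close>; for \<open>\<beta>\<close> near 1 it is the same half plane up to an error of order
  \<open>1 - \<beta>\<close> as long as \<open>w\<close> stays bounded.
\<close>

lemma inverse_difference_disk: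
  assumes "cmod z \<le> 1" "z \<noteq> complex_of_real \<beta>"
  defines "w \<equiv> 1 / (complex_of_real \<beta> - z)"
  shows "1 - (1 - \<beta>\<^sup>2) * (cmod w)\<^sup>2 \<le> 2 * \<beta> * Re w"
proof -
  have "z * w = complex_of_real \<beta> * w - 1"
    using assms(2) unfolding w_def by (simp add: field_simps)
  then have "cmod (complex_of_real \<beta> * w - 1) = cmod z * cmod w"
    by (metis norm_mult)
  also have "\<dots> \<le> cmod w" using assms(1) by (simp add: mult_left_le_one_le)
  finally have "(cmod (complex_of_real \<beta> * w - 1))\<^sup>2 \<le> (cmod w)\<^sup>2"
    by (simp add: power_mono)
  then show ?thesis
    unfolding cmod_power2 by (simp add: power2_eq_square algebra_simps)
qed

lemma radius_bounds:
  fixes \<beta> :: real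
  assumes "0 \<le> \<beta>" "\<beta> \<le> 1"
  shows "9 / 10 < 1 - 3 / 10 * \<beta> * (1 - \<beta>)"
proof -
  have "4 * (\<beta> * (1 - \<beta>)) \<le> 1"
    using zero_le_power2[of "2 * \<beta> - 1"] by (simp add: power2_eq_square algebra_simps)
  moreover have "3 / 10 * \<beta> * (1 - \<beta>) = 3 / 10 * (\<beta> * (1 - \<beta>))" by simp
  ultimately show ?thesis by linarith
qed

text \<open>
  Both sides are the value of the derivative of \<open>P\<close> at \<open>\<beta>\<close>.
\<close>

lemma far_critical_prod:
  assumes "far_critical N \<beta> z \<zeta>"
  shows "(\<Prod>i<N. complex_of_real \<beta> - z i) = of_nat (Suc N) * (\<Prod>k<N. complex_of_real \<beta> - \<zeta> k)"
proof -
  have "poly (pderiv ([:- complex_of_real \<beta>, 1:] * root_prod N z)) (complex_of_real \<beta>)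
      = poly (smult (of_nat (Suc N)) (root_prod N \<zeta>)) (complex_of_real \<beta>)"
    using assms by (simp only: far_critical_def)
  then show ?thesis
    unfolding pderiv_mult poly_add poly_mult poly_smult poly_root_prod
    by (simp add: pderiv_pCons)
qed

lemma far_critical_distinct:
  assumes "far_critical N \<beta> z \<zeta>" "0 \<le> \<beta>" "\<beta> \<le> 1" "i < N"
  shows "\<zeta> i \<noteq> complex_of_real \<beta>" "z i \<noteq> complex_of_real \<beta>"
proof -
  have ne: "\<zeta> k \<noteq> complex_of_real \<beta>" if "k < N" for k
  proof
    assume "\<zeta> k = complex_of_real \<beta>"
    then have "1 - 3 / 10 * \<beta> * (1 - \<beta>) < 0"
      using assms(1) that unfolding far_critical_def by force
    with radius_bounds[OF assms(2,3)] show False by simp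
  qed
  then show "\<zeta> i \<noteq> complex_of_real \<beta>" using assms(4) .
  have "(\<Prod>k<N. complex_of_real \<beta> - \<zeta> k) \<noteq> 0"
    using ne by force
  then have "(\<Prod>i<N. complex_of_real \<beta> - z i) \<noteq> 0"
    unfolding far_critical_prod[OF assms(1)] by (simp del: of_nat_Suc)
  then show "z i \<noteq> complex_of_real \<beta>"
    using assms(4) by force
qed

text \<open>
  Both sides are \<open>P''(\<beta>) / P'(\<beta>)\<close>: the left one by logarithmic differentiation of \<open>P'\<close>, the right
  one because \<open>P = (x - \<beta>) G\<close> has \<open>P'(\<beta>) = G(\<beta>)\<close> and \<open>P''(\<beta>) = 2 G'(\<beta>)\<close>.
\<close>

lemma far_critical_sum:
  assumes "far_critical N \<beta> z \<zeta>" "0 \<le> \<beta>" "\<beta> \<le> 1"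
  shows "(\<Sum>k<N. 1 / (complex_of_real \<beta> - \<zeta> k)) = 2 * (\<Sum>i<N. 1 / (complex_of_real \<beta> - z i))"
proof -
  let ?b = "complex_of_real \<beta>"
  define G where "G = root_prod N z"
  have "pderiv (pderiv ([:- ?b, 1:] * G)) = smult (of_nat (Suc N)) (pderiv (root_prod N \<zeta>))"
    using assms(1) unfolding far_critical_def G_def pderiv_smult[symmetric] by simp
  moreover have "poly (pderiv (pderiv ([:- ?b, 1:] * G))) ?b = 2 * poly (pderiv G) ?b"
    unfolding pderiv_mult pderiv_add poly_add poly_mult by (simp add: pderiv_pCons)
  ultimately have "2 * poly (pderiv G) ?b = of_nat (Suc N) * poly (pderiv (root_prod N \<zeta>)) ?b"
    by (metis poly_smult)
  moreover have "poly (pderiv G) ?b = poly G ?b * (\<Sum>i<N. 1 / (?b - z i))"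
    unfolding G_def by (rule poly_pderiv_root_prod) (use far_critical_distinct[OF assms] in metis)
  moreover have "poly (pderiv (root_prod N \<zeta>)) ?b
      = poly (root_prod N \<zeta>) ?b * (\<Sum>k<N. 1 / (?b - \<zeta> k))"
    by (rule poly_pderiv_root_prod) (use far_critical_distinct[OF assms] in metis)
  moreover have "poly G ?b = of_nat (Suc N) * poly (root_prod N \<zeta>) ?b"
    unfolding G_def poly_root_prod by (rule far_critical_prod[OF assms(1)])
  moreover have "poly G ?b \<noteq> 0"
    unfolding G_def poly_root_prod using far_critical_distinct(2)[OF assms] by force
  ultimately have "poly G ?b * (2 * (\<Sum>i<N. 1 / (?b - z i))) = poly G ?b * (\<Sum>k<N. 1 / (?b - \<zeta> k))"
    by (simp add: mult.assoc mult.left_commute)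
  with \<open>poly G ?b \<noteq> 0\<close> show ?thesis by simp
qed

text \<open>
  On the circle the two sides of the previous identity contradict each other: every term
  \<open>1 / (1 - z i)\<close> has real part at least \<open>1 / 2\<close>, every term \<open>1 / (1 - \<zeta> k)\<close> has modulus less than 1.
\<close>

lemma no_far_critical_at_1:
  assumes "0 < N"
  shows "\<not> far_critical N 1 z \<zeta>"
proof
  assume far: "far_critical N 1 z \<zeta>"
  have "1 / 2 \<le> Re (1 / (1 - z i))" if "i < N" for i
    using inverse_difference_disk[of "z i" 1] far far_critical_distinct(2)[OF far _ _ that] that
    by (simp add: far_critical_def)
  then have "(\<Sum>i<N. 1 / 2) \<le> (\<Sum>i<N. Re (1 / (1 - z i)))"
    by (intro sum_mono) simp
  then have "real N \<le> Re (\<Sum>k<N. 1 / (1 - \<zeta> k))"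
    using far_critical_sum[OF far] by simp
  also have "\<dots> = (\<Sum>k<N. Re (1 / (1 - \<zeta> k)))" by (rule Re_sum)
  also have "\<dots> < (\<Sum>k<N. 1)"
  proof (rule sum_strict_mono)
    fix k assume "k \<in> {..<N}"
    then have "1 < cmod (\<zeta> k - 1)" using far by (simp add: far_critical_def)
    then have "1 < cmod (1 - \<zeta> k)" by (simp add: norm_minus_commute)
    then have "cmod (1 / (1 - \<zeta> k)) < 1" by (simp add: norm_divide divide_less_eq)
    then show "Re (1 / (1 - \<zeta> k)) < 1" using complex_Re_le_cmod[of "1 / (1 - \<zeta> k)"] by linarith
  qed (use assms in auto)
  finally show False by simp
qed

lemma no_far_critical_quadratic:
  assumes "0 \<le> \<beta>" "\<beta> \<le> 1"
  shows "\<not> far_critical 1 \<beta> z \<zeta>"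
proof
  assume far: "far_critical 1 \<beta> z \<zeta>"
  have "complex_of_real \<beta> - z 0 = 2 * (complex_of_real \<beta> - \<zeta> 0)"
    using far_critical_prod[OF far] by simp
  then have "2 * cmod (\<zeta> 0 - complex_of_real \<beta>) = cmod (complex_of_real \<beta> - z 0)"
    unfolding norm_minus_commute[of "\<zeta> 0"] by (metis norm_mult norm_numeral)
  also have "\<dots> \<le> \<beta> + 1"
    using norm_triangle_ineq4[of "complex_of_real \<beta>" "z 0"] far assms
    by (simp add: far_critical_def)
  finally have "cmod (\<zeta> 0 - complex_of_real \<beta>) \<le> (\<beta> + 1) / 2" by simp
  moreover have "1 - 3 / 10 * \<beta> * (1 - \<beta>) < cmod (\<zeta> 0 - complex_of_real \<beta>)"
    using far by (simp add: far_critical_def)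
  moreover have "3 / 10 * \<beta> * (1 - \<beta>) \<le> (3 / 10 * 1) * (1 - \<beta>)"
    using assms by (intro mult_right_mono mult_left_mono) auto
  ultimately have "1 - (3 / 10 * 1) * (1 - \<beta>) < (\<beta> + 1) / 2" by (meson diff_left_mono le_less_trans less_le_trans)
  then show False using assms by (simp add: field_simps)
qed

text \<open>
  A point that is nearly as far right as its modulus allows has imaginary part of the order of the
  square root of the defect. This is why the real parts of the critical points are of order
  \<open>1 - \<beta>\<close> but the imaginary parts only of order \<open>sqrt (1 - \<beta>)\<close>.
\<close>

lemma inverse_near_1:
  fixes u :: complex
  assumes "0 \<le> \<epsilon>" "\<epsilon> \<le> 1" "1 \<le> K" "K * \<epsilon> \<le> 1 / 2" "1 - K * \<epsilon> \<le> Re u" "cmod u \<le> 1 + \<epsilon>"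
  shows "\<bar>1 - Re (1 / u)\<bar> \<le> (12 + 16 * K) * \<epsilon>" "(Im (1 / u))\<^sup>2 \<le> (48 + 32 * K) * \<epsilon>"
proof -
  define v where "v = (cmod u)\<^sup>2"
  have Re: "1 / 2 \<le> Re u" "Re u \<le> 2" "\<bar>Re u - 1\<bar> \<le> K * \<epsilon>"
    using assms complex_Re_le_cmod[of u] mult_right_mono[of 1 K \<epsilon>] by auto
  have v_eq: "v = (Re u)\<^sup>2 + (Im u)\<^sup>2" by (simp add: v_def cmod_power2)
  have "(1 / 2)\<^sup>2 \<le> (Re u)\<^sup>2" by (rule power_mono) (use Re in auto)
  then have v: "1 / 4 \<le> v" unfolding v_eq by (simp add: power2_eq_square add_increasing2)
  have "v \<le> (1 + \<epsilon>)\<^sup>2" unfolding v_def by (rule power_mono) (use assms in auto)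
  moreover have "(1 - K * \<epsilon>)\<^sup>2 \<le> (Re u)\<^sup>2" by (rule power_mono) (use assms in auto)
  ultimately have "(Im u)\<^sup>2 \<le> (1 + \<epsilon>)\<^sup>2 - (1 - K * \<epsilon>)\<^sup>2" unfolding v_eq by linarith
  also have "\<dots> = 2 * \<epsilon> + 2 * (K * \<epsilon>) + \<epsilon>\<^sup>2 - (K * \<epsilon>)\<^sup>2" by (simp add: power2_eq_square algebra_simps)
  also have "\<dots> \<le> 2 * \<epsilon> + 2 * (K * \<epsilon>) + \<epsilon>\<^sup>2" by simp
  also have "\<dots> \<le> (3 + 2 * K) * \<epsilon>"
    using mult_left_mono[OF assms(2,1)] by (simp add: power2_eq_square algebra_simps)
  finally have Im: "(Im u)\<^sup>2 \<le> (3 + 2 * K) * \<epsilon>" .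
  have "1 - Re (1 / u) = (v - Re u) / v"
    using v unfolding Re_divide v_eq[symmetric] by (simp add: v_eq[symmetric] diff_divide_distrib)
  also have "v - Re u = Re u * (Re u - 1) + (Im u)\<^sup>2"
    unfolding v_eq by (simp add: power2_eq_square algebra_simps)
  finally have eq: "1 - Re (1 / u) = (Re u * (Re u - 1) + (Im u)\<^sup>2) / v" .
  have "\<bar>Re u * (Re u - 1)\<bar> \<le> 2 * (K * \<epsilon>)"
    unfolding abs_mult by (rule mult_mono) (use Re in auto)
  then have "\<bar>Re u * (Re u - 1) + (Im u)\<^sup>2\<bar> \<le> 2 * (K * \<epsilon>) + (3 + 2 * K) * \<epsilon>"
    using Im zero_le_power2[of "Im u"] unfolding abs_le_iff by linarith
  also have "\<dots> = (3 + 4 * K) * \<epsilon>" by (simp add: algebra_simps)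
  also have "\<dots> \<le> (12 + 16 * K) * \<epsilon> * v"
    using mult_left_mono[OF v, of "(12 + 16 * K) * \<epsilon>"] assms by (simp add: algebra_simps)
  finally show "\<bar>1 - Re (1 / u)\<bar> \<le> (12 + 16 * K) * \<epsilon>"
    unfolding eq using v by (simp add: abs_divide divide_le_eq)
  have "(Im (1 / u))\<^sup>2 = (Im u)\<^sup>2 / v\<^sup>2"
    by (simp add: Im_divide v_eq[symmetric] power_divide)
  also have "\<dots> \<le> (3 + 2 * K) * \<epsilon> / (1 / 4)\<^sup>2"
    by (rule frac_le) (use Im v assms in \<open>auto intro: power_mono\<close>)
  finally show "(Im (1 / u))\<^sup>2 \<le> (48 + 32 * K) * \<epsilon>" by (simp add: power2_eq_square algebra_simps)
qed

text \<open>
  The argument of the case \<open>\<beta> = 1\<close> made quantitative. The sum of the \<open>1 / (\<beta> - \<zeta> k)\<close> has real part at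
  least \<open>N - O(1 - \<beta>)\<close> while each term has modulus at most \<open>1 + (1 - \<beta>)\<close>, so every single term is
  close to 1. The other roots must not be too close to \<open>\<beta>\<close> for the first estimate; this follows
  from the product formula, since the critical points are far from \<open>\<beta>\<close>.
\<close>

lemma far_critical_points_small:
  assumes "0 < N"
  shows "\<exists>C>0. \<exists>\<delta>>0. \<forall>\<beta> z \<zeta>. far_critical N \<beta> z \<zeta> \<longrightarrow> 1 - \<delta> \<le> \<beta> \<longrightarrow> \<beta> \<le> 1 \<longrightarrow>
    (\<forall>k<N. \<bar>Re (\<zeta> k)\<bar> \<le> C * (1 - \<beta>) \<and> (Im (\<zeta> k))\<^sup>2 \<le> C * (1 - \<beta>))"
proof -
  define B :: real where "B = 2 * 16 ^ N"
  define K where "K = 2 * real N * B + real N"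
  have "1 \<le> B" unfolding B_def using one_le_power[of "16::real" N] by linarith
  have K: "1 \<le> K" unfolding K_def using assms \<open>1 \<le> B\<close> by (simp add: add_increasing)
  define C where "C = 48 + 32 * K"
  define \<delta> where "\<delta> = 1 / (2 * K)"
  have \<delta>: "0 < \<delta>" "\<delta> \<le> 1 / 2" "K * \<delta> = 1 / 2" using K by (auto simp: \<delta>_def field_simps)
  have "\<bar>Re (\<zeta> k)\<bar> \<le> C * (1 - \<beta>) \<and> (Im (\<zeta> k))\<^sup>2 \<le> C * (1 - \<beta>)"
    if far: "far_critical N \<beta> z \<zeta>" and b: "1 - \<delta> \<le> \<beta>" "\<beta> \<le> 1" and k: "k < N" for \<beta> z \<zeta> k
  proof -
    let ?b = "complex_of_real \<beta>"
    define \<epsilon> where "\<epsilon> = 1 - \<beta>"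
    define r where "r = 1 - 3 / 10 * \<beta> * (1 - \<beta>)"
    have e: "0 \<le> \<epsilon>" "\<epsilon> \<le> \<delta>" "\<epsilon> \<le> 1 / 2" using b \<delta> by (auto simp: \<epsilon>_def)
    have b': "1 / 2 \<le> \<beta>" "0 \<le> \<beta>" using e by (auto simp: \<epsilon>_def)
    have r: "9 / 10 < r" unfolding r_def using b' b by (intro radius_bounds) auto
    have \<zeta>r: "r < cmod (?b - \<zeta> j)" if "j < N" for j
      using far that by (simp add: far_critical_def r_def norm_minus_commute)
    have z1: "cmod (z i) \<le> 1" if "i < N" for i using far that by (simp add: far_critical_def)
    \<comment> \<open>The factors other than the one considered are at most 2, whence the constant.\<close>
    have zdist: "(1 / 4) ^ N \<le> cmod (?b - z i)" if i: "i < N" for i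
    proof -
      have "(1 / 2) ^ N \<le> r ^ N" by (rule power_mono) (use r in auto)
      also have "r ^ N = (\<Prod>j<N. r)" by simp
      also have "\<dots> \<le> (\<Prod>j<N. cmod (?b - \<zeta> j))"
        by (rule prod_mono) (use \<zeta>r r in \<open>auto intro: less_imp_le\<close>)
      also have "\<dots> \<le> real (Suc N) * (\<Prod>j<N. cmod (?b - \<zeta> j))"
        by (simp add: distrib_right prod_nonneg)
      also have "\<dots> = cmod (\<Prod>i<N. ?b - z i)"
        unfolding far_critical_prod[OF far] norm_mult norm_of_nat prod_norm ..
      also have "\<dots> = cmod (?b - z i) * (\<Prod>j\<in>{..<N} - {i}. cmod (?b - z j))"
        unfolding prod_norm[symmetric] by (rule prod.remove) (use i in auto)
      also have "\<dots> \<le> cmod (?b - z i) * (\<Prod>j\<in>{..<N} - {i}. 2)"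
      proof (intro mult_left_mono prod_mono conjI)
        fix j assume "j \<in> {..<N} - {i}"
        then show "cmod (?b - z j) \<le> 2"
          using norm_triangle_ineq4[of ?b "z j"] z1[of j] b b' by simp
      qed auto
      also have "\<dots> \<le> cmod (?b - z i) * 2 ^ N"
        using i by (intro mult_left_mono) (auto intro: power_increasing)
      finally show ?thesis
        by (simp add: field_simps flip: power_mult_distrib mult.assoc)
    qed
    have w: "1 / 2 - B * \<epsilon> \<le> Re (1 / (?b - z i))" if i: "i < N" for i
    proof -
      let ?w = "1 / (?b - z i)"
      have "cmod ?w \<le> 1 / (1 / 4) ^ N"
        unfolding norm_divide norm_one by (rule frac_le) (use zdist[OF i] in auto)
      then have "(cmod ?w)\<^sup>2 \<le> (4 ^ N)\<^sup>2" by (intro power_mono) (auto simp: power_one_over)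
      also have "\<dots> = (16::real) ^ N" by (simp add: power_mult_distrib[symmetric] power2_eq_square)
      finally have w2: "(cmod ?w)\<^sup>2 \<le> 16 ^ N" .
      have "0 \<le> 1 - \<beta>\<^sup>2" "1 - \<beta>\<^sup>2 \<le> 2 * \<epsilon>"
        using b b' zero_le_power2[of "1 - \<beta>"] power_le_one[of \<beta> 2]
        unfolding \<epsilon>_def by (auto simp: power2_eq_square algebra_simps)
      then have "(1 - \<beta>\<^sup>2) * (cmod ?w)\<^sup>2 \<le> (2 * \<epsilon>) * 16 ^ N"
        using w2 e by (intro mult_mono) auto
      then have low: "1 - B * \<epsilon> \<le> 2 * \<beta> * Re ?w"
        using inverse_difference_disk[OF z1[OF i] far_critical_distinct(2)[OF far b'(2) b(2) i]]
        by (simp add: B_def algebra_simps)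
      show ?thesis
      proof (cases "0 \<le> Re ?w")
        case True
        then have "2 * \<beta> * Re ?w \<le> 2 * Re ?w" using b by (simp add: mult_right_mono)
        moreover have "0 \<le> B * \<epsilon>" using \<open>1 \<le> B\<close> e by simp
        ultimately show ?thesis using low by linarith
      next
        case False
        then have "2 * \<beta> * Re ?w \<le> 1 * Re ?w" using b' by (intro mult_right_mono_neg) auto
        then show ?thesis using low by linarith
      qed
    qed
    have ub: "cmod (1 / (?b - \<zeta> j)) \<le> 1 + \<epsilon>" if j: "j < N" for j
    proof -
      have "\<beta> * (1 + \<epsilon>) \<le> 1 * (1 + 1 / 2)" by (rule mult_mono) (use e b b' in auto)
      then have "0 \<le> \<epsilon> * (1 - 3 / 10 * (\<beta> * (1 + \<epsilon>)))" using e by simp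
      then have "1 \<le> (1 + \<epsilon>) * r" unfolding r_def \<epsilon>_def[symmetric] by (simp add: algebra_simps)
      also have "\<dots> \<le> (1 + \<epsilon>) * cmod (?b - \<zeta> j)"
        using \<zeta>r[OF j] e by (intro mult_left_mono) auto
      finally show ?thesis using \<zeta>r[OF j] r e by (simp add: norm_divide divide_le_eq)
    qed
    have "(\<Sum>i<N. 1 / 2 - B * \<epsilon>) \<le> (\<Sum>i<N. Re (1 / (?b - z i)))"
      by (intro sum_mono w) simp
    then have "real N - 2 * real N * B * \<epsilon> \<le> Re (2 * (\<Sum>i<N. 1 / (?b - z i)))"
      by (simp add: algebra_simps)
    also have "\<dots> = (\<Sum>j<N. Re (1 / (?b - \<zeta> j)))"
      unfolding far_critical_sum[OF far b'(2) b(2), symmetric] by (rule Re_sum)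
    also have "\<dots> = Re (1 / (?b - \<zeta> k)) + (\<Sum>j\<in>{..<N} - {k}. Re (1 / (?b - \<zeta> j)))"
      by (rule sum.remove) (use k in auto)
    also have "\<dots> \<le> Re (1 / (?b - \<zeta> k)) + (\<Sum>j\<in>{..<N} - {k}. 1 + \<epsilon>)"
    proof (intro add_left_mono sum_mono)
      fix j assume "j \<in> {..<N} - {k}"
      then show "Re (1 / (?b - \<zeta> j)) \<le> 1 + \<epsilon>"
        using ub[of j] complex_Re_le_cmod[of "1 / (?b - \<zeta> j)"] by auto
    qed
    also have "\<dots> = Re (1 / (?b - \<zeta> k)) + (real N - 1) * (1 + \<epsilon>)"
      using k by (simp add: of_nat_diff)
    finally have lo: "1 - K * \<epsilon> \<le> Re (1 / (?b - \<zeta> k))"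
      using e unfolding K_def by (simp add: algebra_simps)
    have Ke: "K * \<epsilon> \<le> 1 / 2" using mult_left_mono[OF e(2), of K] K \<delta> by simp
    have e1: "\<epsilon> \<le> 1" using e by simp
    note inv = inverse_near_1[OF e(1) e1 K Ke lo ub[OF k]]
    have "1 / (1 / (?b - \<zeta> k)) = ?b - \<zeta> k" by simp
    with inv have "\<bar>1 - (\<beta> - Re (\<zeta> k))\<bar> \<le> (12 + 16 * K) * \<epsilon>" "(Im (\<zeta> k))\<^sup>2 \<le> (48 + 32 * K) * \<epsilon>"
      by simp_all
    then have "\<bar>Re (\<zeta> k)\<bar> \<le> (12 + 16 * K) * \<epsilon> + \<epsilon>" "(Im (\<zeta> k))\<^sup>2 \<le> C * \<epsilon>"
      using e unfolding \<epsilon>_def C_def by linarith+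
    moreover have "(12 + 16 * K) * \<epsilon> + \<epsilon> \<le> C * \<epsilon>"
      using K e unfolding C_def by (simp add: algebra_simps mult_right_mono)
    ultimately show ?thesis unfolding \<epsilon>_def by linarith
  qed
  then show ?thesis using \<delta>(1) K unfolding C_def by (intro exI[of _ "48 + 32 * K"] conjI exI[of _ \<delta>]) auto
qed

section \<open>The polynomial as a perturbation of a power minus one\<close>

lemma tendsto_coeff_root_prod:
  assumes "\<And>k. k < N \<Longrightarrow> (\<lambda>m. a m k) \<longlonglongrightarrow> l k"
  shows "(\<lambda>m. coeff (root_prod N (a m)) i) \<longlonglongrightarrow> coeff (root_prod N l) i"
  using assms
proof (induction N arbitrary: i)
  case (Suc N)
  have IH: "(\<lambda>m. coeff (root_prod N (a m)) i) \<longlonglongrightarrow> coeff (root_prod N l) i" for i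
    using Suc by simp
  show ?case
  proof (cases i)
    case 0
    then show ?thesis unfolding 0 coeff_root_prod_Suc by (intro tendsto_intros IH Suc.prems) simp
  next
    case (Suc j)
    show ?thesis unfolding Suc coeff_root_prod_Suc by (intro tendsto_intros IH Suc.prems) simp
  qed
qed simp

lemma coeff_root_prod_scale:
  assumes "i \<le> N"
  shows "coeff (root_prod N (\<lambda>k. c * a k)) i = c ^ (N - i) * coeff (root_prod N a) i"
  using assms
proof (induction N arbitrary: i)
  case (Suc N)
  have *: "c * a N * coeff (root_prod N (\<lambda>k. c * a k)) j
      = c ^ (Suc N - j) * (a N * coeff (root_prod N a) j)" if "j \<le> Suc N" for j
  proof (cases "j = Suc N")
    case True
    then show ?thesis by (simp add: coeff_eq_0)
  next
    case False
    then have "j \<le> N" using that by simp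
    then show ?thesis by (simp add: Suc.IH Suc_diff_le)
  qed
  show ?case
  proof (cases i)
    case 0
    then show ?thesis using *[of 0] by (simp add: coeff_root_prod_Suc)
  next
    case (Suc j)
    then have "j \<le> N" using Suc.prems by simp
    then show ?thesis unfolding Suc coeff_root_prod_Suc using *[of "Suc j"] Suc.IH[of j]
      by (simp add: right_diff_distrib)
  qed
qed simp

text \<open>
  With the derivative given, \<open>P(w) = w^(N+1) - 1 + perturbation N \<beta> \<zeta> w\<close>, where the constant of
  integration is fixed by \<open>P(\<beta>) = 0\<close>. All critical points are small, hence so is the perturbation.
\<close>

definition perturbation :: "nat \<Rightarrow> real \<Rightarrow> (nat \<Rightarrow> complex) \<Rightarrow> complex \<Rightarrow> complex" where
  "perturbation N \<beta> \<zeta> w = 1 - complex_of_real \<beta> ^ Suc N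
     + (\<Sum>k<N. of_nat (Suc N) / of_nat (Suc k) * coeff (root_prod N \<zeta>) k
          * (w ^ Suc k - complex_of_real \<beta> ^ Suc k))"

lemma far_critical_poly:
  assumes "far_critical N \<beta> z \<zeta>"
  shows "(w - complex_of_real \<beta>) * (\<Prod>i<N. w - z i) = w ^ Suc N - 1 + perturbation N \<beta> \<zeta> w"
proof -
  let ?b = "complex_of_real \<beta>"
  define P where "P = [:- ?b, 1:] * root_prod N z"
  have P': "pderiv P = smult (of_nat (Suc N)) (root_prod N \<zeta>)"
    using assms by (simp add: far_critical_def P_def)
  have "degree P = Suc N" unfolding P_def by (subst degree_mult_eq) auto
  then have "poly P w - poly P ?b = (\<Sum>k<Suc N. coeff (pderiv P) k / of_nat (Suc k) * (w ^ Suc k - ?b ^ Suc k))"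
    using poly_diff_eq_sum_pderiv[of P w ?b] by simp
  also have "\<dots> = w ^ Suc N - 1 + perturbation N \<beta> \<zeta> w"
    unfolding P' perturbation_def sum.lessThan_Suc by (simp del: of_nat_Suc power_Suc)
  finally show ?thesis unfolding P_def poly_mult poly_root_prod by (simp add: add.commute del: power_Suc)
qed

text \<open>
  At a root the perturbation equals \<open>1 - w^(N+1)\<close>, and \<open>w^(N+1)\<close> lies in the unit disk. This is the
  way in which the location of the roots enters all first order estimates.
\<close>

lemma perturbation_nonneg:
  assumes "w ^ Suc N - 1 + perturbation N \<beta> \<zeta> w = 0" "cmod w \<le> 1"
  shows "0 \<le> Re (perturbation N \<beta> \<zeta> w)"
proof -
  have "Re (w ^ Suc N) \<le> cmod (w ^ Suc N)" by (rule complex_Re_le_cmod)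
  also have "\<dots> \<le> 1" unfolding norm_power by (rule power_le_one) (use assms in auto)
  finally have "Re (w ^ Suc N) \<le> 1" .
  moreover have "perturbation N \<beta> \<zeta> w = 1 - w ^ Suc N" using assms(1) by (simp add: algebra_simps)
  ultimately show ?thesis by simp
qed

text \<open>
  The value of \<open>P\<close> at a root of unity \<open>u\<close> is the perturbation there, and also the product of the
  distances from \<open>u\<close> to the roots; so the nearest root is close.
\<close>

lemma far_critical_root_near_unity:
  assumes far: "far_critical N \<beta> z \<zeta>" and b: "0 \<le> \<beta>" "\<beta> \<le> 1" and u: "u ^ Suc N = 1"
  shows "\<exists>w. w ^ Suc N - 1 + perturbation N \<beta> \<zeta> w = 0 \<and> cmod w \<le> 1
    \<and> cmod (u - w) ^ Suc N \<le> cmod (perturbation N \<beta> \<zeta> u)"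
proof -
  let ?b = "complex_of_real \<beta>"
  define R where "R = insert ?b (z ` {..<N})"
  have R: "finite R" "R \<noteq> {}" by (auto simp: R_def)
  obtain w where w: "w \<in> R" "\<And>v. v \<in> R \<Longrightarrow> cmod (u - w) \<le> cmod (u - v)"
    using arg_min_if_finite(1)[OF R, of "\<lambda>v. cmod (u - v)"] arg_min_least[OF R, of _ "\<lambda>v. cmod (u - v)"] by blast
  have "(w - ?b) * (\<Prod>i<N. w - z i) = 0" using w(1) by (auto simp: R_def)
  then have "w ^ Suc N - 1 + perturbation N \<beta> \<zeta> w = 0"
    using far_critical_poly[OF far, of w] by simp
  moreover have "cmod w \<le> 1" using w(1) far b by (auto simp: R_def far_critical_def)
  moreover have "cmod (u - w) ^ Suc N \<le> cmod (perturbation N \<beta> \<zeta> u)"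
  proof -
    have "cmod (u - w) ^ Suc N = cmod (u - w) * (\<Prod>i<N. cmod (u - w))" by simp
    also have "\<dots> \<le> cmod (u - ?b) * (\<Prod>i<N. cmod (u - z i))"
      by (intro mult_mono prod_mono conjI prod_nonneg w(2)) (auto simp: R_def)
    also have "\<dots> = cmod ((u - ?b) * (\<Prod>i<N. u - z i))" by (simp only: norm_mult prod_norm)
    also have "\<dots> = cmod (perturbation N \<beta> \<zeta> u)" unfolding far_critical_poly[OF far] u by simp
    finally show ?thesis .
  qed
  ultimately show ?thesis by blast
qed

lemma ex_unity_Im_pos: "\<exists>u. u ^ Suc (Suc (Suc p)) = 1 \<and> 0 < Im u"
proof (intro exI conjI)
  let ?n = "real (Suc (Suc (Suc p)))"
  have "cis (2 * pi / ?n) ^ Suc (Suc (Suc p)) = cis (?n * (2 * pi / ?n))" by (rule Complex.DeMoivre)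
  also have "?n * (2 * pi / ?n) = 2 * pi" by (simp del: of_nat_Suc)
  finally show "cis (2 * pi / ?n) ^ Suc (Suc (Suc p)) = 1" by (simp only: cis_2pi)
  have "2 * pi < ?n * pi" by (rule mult_strict_right_mono) auto
  then have "2 * pi / ?n < pi" by (simp add: divide_less_eq mult.commute del: of_nat_Suc)
  then show "0 < Im (cis (2 * pi / ?n))"
    by (simp add: sin_gt_zero del: of_nat_Suc)
qed

section \<open>First order analysis of a degenerating sequence\<close>

text \<open>
  A sequence of configurations with \<open>\<beta>\<close> tending to 1 along which the critical points converge at
  their natural scales: real parts at scale \<open>1 - \<beta>\<close>, imaginary parts at scale \<open>sqrt (1 - \<beta>)\<close>. The
  degree of the polynomials is \<open>p + 3\<close>.
\<close>

locale far_critical_limit =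
  fixes p :: nat and \<beta> :: "nat \<Rightarrow> real" and z \<zeta> :: "nat \<Rightarrow> nat \<Rightarrow> complex" and \<xi> \<eta> :: "nat \<Rightarrow> real"
  assumes far: "far_critical (Suc (Suc p)) (\<beta> m) (z m) (\<zeta> m)"
    and \<beta>: "0 \<le> \<beta> m" "\<beta> m < 1"
    and \<beta>_lim: "\<beta> \<longlonglongrightarrow> 1"
    and \<xi>: "k < Suc (Suc p) \<Longrightarrow> (\<lambda>m. Re (\<zeta> m k) / (1 - \<beta> m)) \<longlonglongrightarrow> \<xi> k"
    and \<eta>: "k < Suc (Suc p) \<Longrightarrow> (\<lambda>m. Im (\<zeta> m k) / sqrt (1 - \<beta> m)) \<longlonglongrightarrow> \<eta> k"
begin

abbreviation N :: nat where "N \<equiv> Suc (Suc p)"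

abbreviation Q :: "nat \<Rightarrow> complex \<Rightarrow> complex" where "Q m \<equiv> perturbation N (\<beta> m) (\<zeta> m)"

definition h :: "nat \<Rightarrow> real" where "h m = sqrt (1 - \<beta> m)"

lemma h_pos: "0 < h m" and h_sq: "(h m)\<^sup>2 = 1 - \<beta> m"
  using \<beta>[of m] by (simp_all add: h_def)

lemma h_lim: "h \<longlonglongrightarrow> 0"
proof -
  have "(\<lambda>m. sqrt (1 - \<beta> m)) \<longlonglongrightarrow> sqrt (1 - 1)" by (intro tendsto_intros \<beta>_lim)
  then show ?thesis by (simp add: h_def[abs_def])
qed

lemma one_minus_power_lim: "(\<lambda>m. (1 - \<beta> m ^ j) / (h m)\<^sup>2) \<longlonglongrightarrow> real j"
proof -
  have "(\<lambda>m. \<Sum>i<j. \<beta> m ^ i) \<longlonglongrightarrow> (\<Sum>i<j. 1 ^ i)" by (intro tendsto_intros \<beta>_lim)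
  moreover have "(1 - \<beta> m ^ j) / (h m)\<^sup>2 = (\<Sum>i<j. \<beta> m ^ i)" for m
    using \<beta>(2)[of m] by (simp add: h_sq one_diff_power_eq)
  ultimately show ?thesis by simp
qed

lemma Re_lim: "k < N \<Longrightarrow> (\<lambda>m. Re (\<zeta> m k) / (h m)\<^sup>2) \<longlonglongrightarrow> \<xi> k"
  using \<xi> by (simp add: h_sq)

lemma Im_lim: "k < N \<Longrightarrow> (\<lambda>m. Im (\<zeta> m k) / h m) \<longlonglongrightarrow> \<eta> k"
  using \<eta> by (simp add: h_def)

lemma scaled_lim: "k < N \<Longrightarrow> (\<lambda>m. \<zeta> m k / of_real (h m)) \<longlonglongrightarrow> \<i> * of_real (\<eta> k)"
proof -
  assume k: "k < N"
  have "(\<lambda>m. h m * (Re (\<zeta> m k) / (h m)\<^sup>2)) \<longlonglongrightarrow> 0 * \<xi> k"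
    by (intro tendsto_intros h_lim Re_lim k)
  moreover have "h m * (Re (\<zeta> m k) / (h m)\<^sup>2) = Re (\<zeta> m k) / h m" for m
    using h_pos[of m] by (simp add: power2_eq_square)
  ultimately have "(\<lambda>m. Re (\<zeta> m k) / h m) \<longlonglongrightarrow> 0" by simp
  then have "(\<lambda>m. Complex (Re (\<zeta> m k) / h m) (Im (\<zeta> m k) / h m)) \<longlonglongrightarrow> Complex 0 (\<eta> k)"
    by (intro tendsto_Complex Im_lim k)
  moreover have "Complex (Re (\<zeta> m k) / h m) (Im (\<zeta> m k) / h m) = \<zeta> m k / of_real (h m)" for m
    by (simp add: complex_eq_iff)
  moreover have "Complex 0 (\<eta> k) = \<i> * of_real (\<eta> k)" by (simp add: complex_eq_iff)
  ultimately show ?thesis by simp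
qed

text \<open>
  Coefficients of the derivative are homogeneous in the critical points, so at scale \<open>h\<close> they
  converge to the coefficients of the polynomial with the purely imaginary roots \<open>\<i> * \<eta> k\<close>.
\<close>

lemma coeff_lim:
  assumes "i \<le> N"
  shows "(\<lambda>m. coeff (root_prod N (\<zeta> m)) i / of_real (h m) ^ (N - i))
    \<longlonglongrightarrow> coeff (root_prod N (\<lambda>k. \<i> * of_real (\<eta> k))) i"
proof -
  have "coeff (root_prod N (\<lambda>k. \<zeta> m k / of_real (h m))) i
      = coeff (root_prod N (\<zeta> m)) i / of_real (h m) ^ (N - i)" for m
  proof -
    have "root_prod N (\<zeta> m) = root_prod N (\<lambda>k. of_real (h m) * (\<zeta> m k / of_real (h m)))"
      using h_pos[of m] by simp
    then show ?thesis
      unfolding coeff_root_prod_scale[OF assms, of "of_real (h m)" "\<lambda>k. \<zeta> m k / of_real (h m)", symmetric]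
      using h_pos[of m] coeff_root_prod_scale[OF assms, of "of_real (h m)" "\<lambda>k. \<zeta> m k / of_real (h m)"]
      by simp
  qed
  then show ?thesis
    using tendsto_coeff_root_prod[of N "\<lambda>m k. \<zeta> m k / of_real (h m)" "\<lambda>k. \<i> * of_real (\<eta> k)" i, OF scaled_lim]
    by simp
qed

lemma coeff_small:
  assumes "i + j < N"
  shows "(\<lambda>m. coeff (root_prod N (\<zeta> m)) i / of_real (h m) ^ j) \<longlonglongrightarrow> 0"
proof -
  define d where "d = N - i - j"
  have d: "N - i = j + d" "0 < d" using assms by (auto simp: d_def)
  have "(\<lambda>m. of_real (h m) ^ d * (coeff (root_prod N (\<zeta> m)) i / of_real (h m) ^ (N - i)))
    \<longlonglongrightarrow> of_real 0 ^ d * coeff (root_prod N (\<lambda>k. \<i> * of_real (\<eta> k))) i"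
    by (intro tendsto_intros h_lim coeff_lim) (use assms in simp)
  moreover have "of_real (h m) ^ d * (coeff (root_prod N (\<zeta> m)) i / of_real (h m) ^ (N - i))
    = coeff (root_prod N (\<zeta> m)) i / of_real (h m) ^ j" for m
    using h_pos[of m] unfolding d(1) by (simp add: power_add)
  ultimately show ?thesis using d(2) by (simp only: of_real_0 zero_power mult_zero_left)
qed

lemma one_minus_power_small:
  "(\<lambda>m. (1 - of_real (\<beta> m) ^ Suc N) / of_real (h m)) \<longlonglongrightarrow> (0 :: complex)"
proof -
  have "(\<lambda>m. of_real (h m * ((1 - \<beta> m ^ Suc N) / (h m)\<^sup>2))) \<longlonglongrightarrow> (of_real (0 * real (Suc N)) :: complex)"
    by (intro tendsto_intros h_lim one_minus_power_lim)
  moreover have "of_real (h m * ((1 - \<beta> m ^ Suc N) / (h m)\<^sup>2))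
      = (1 - of_real (\<beta> m) ^ Suc N) / (of_real (h m) :: complex)" for m
    using h_pos[of m] by (simp add: power2_eq_square)
  ultimately show ?thesis by simp
qed

text \<open>
  At scale \<open>h\<close> only the sum of the critical points contributes.
\<close>

lemma perturbation_over_h:
  assumes "w \<longlonglongrightarrow> v"
  shows "(\<lambda>m. Q m (w m) / of_real (h m)) \<longlonglongrightarrow>
    of_nat (Suc N) / of_nat N * (- (\<i> * of_real (\<Sum>k<N. \<eta> k))) * (v ^ N - 1)"
proof -
  let ?t = "\<lambda>m k. of_nat (Suc N) / of_nat (Suc k) * (coeff (root_prod N (\<zeta> m)) k / of_real (h m))
          * (w m ^ Suc k - of_real (\<beta> m) ^ Suc k)"
  have eq: "Q m (w m) / of_real (h m) = (1 - of_real (\<beta> m) ^ Suc N) / of_real (h m)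
      + (\<Sum>k<Suc p. ?t m k) + ?t m (Suc p)" for m
    unfolding perturbation_def add_divide_distrib sum_divide_distrib sum.lessThan_Suc[of _ "Suc p"]
    by (simp only: add.assoc times_divide_eq_right times_divide_eq_left)
  have small: "(\<lambda>m. ?t m k) \<longlonglongrightarrow> of_nat (Suc N) / of_nat (Suc k) * 0 * (v ^ Suc k - of_real 1 ^ Suc k)"
    if "k < Suc p" for k
    using coeff_small[of k 1] that
    by (intro tendsto_intros assms \<beta>_lim) (auto simp del: of_nat_Suc)
  have top: "coeff (root_prod N (\<lambda>k. \<i> * of_real (\<eta> k))) (Suc p) = - (\<i> * of_real (\<Sum>k<N. \<eta> k))"
    unfolding coeff_root_prod_e1 by (simp add: sum_distrib_left algebra_simps)
  have big: "(\<lambda>m. ?t m (Suc p)) \<longlonglongrightarrow> of_nat (Suc N) / of_nat (Suc (Suc p)) * (- (\<i> * of_real (\<Sum>k<N. \<eta> k)))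
      * (v ^ Suc (Suc p) - of_real 1 ^ Suc (Suc p))"
    using coeff_lim[of "Suc p"] unfolding top
    by (intro tendsto_intros assms \<beta>_lim) (auto simp del: of_nat_Suc)
  have "(\<lambda>m. Q m (w m) / of_real (h m)) \<longlonglongrightarrow>
     0 + (\<Sum>k<Suc p. of_nat (Suc N) / of_nat (Suc k) * 0 * (v ^ Suc k - of_real 1 ^ Suc k))
     + of_nat (Suc N) / of_nat (Suc (Suc p)) * (- (\<i> * of_real (\<Sum>k<N. \<eta> k)))
      * (v ^ Suc (Suc p) - of_real 1 ^ Suc (Suc p))"
    unfolding eq by (intro tendsto_add tendsto_sum one_minus_power_small small big) simp
  then show ?thesis by (simp del: of_nat_Suc power_Suc)
qed

lemma perturbation_lim: "(\<lambda>m. Q m u) \<longlonglongrightarrow> 0"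
proof -
  have "(\<lambda>m. of_real (h m) * (Q m u / of_real (h m))) \<longlonglongrightarrow>
    of_real 0 * (of_nat (Suc N) / of_nat N * (- (\<i> * of_real (\<Sum>k<N. \<eta> k))) * (u ^ N - 1))"
    by (intro tendsto_mult tendsto_of_real h_lim perturbation_over_h tendsto_const)
  moreover have "of_real (h m) * (Q m u / of_real (h m)) = Q m u" for m
    using h_pos[of m] by simp
  ultimately show ?thesis by simp
qed

lemma near_root_sequence:
  assumes u: "u ^ Suc N = 1"
  obtains w where "w \<longlonglongrightarrow> u" "\<And>m. 0 \<le> Re (Q m (w m))"
proof -
  have "\<exists>w. w ^ Suc N - 1 + Q m w = 0 \<and> cmod w \<le> 1 \<and> cmod (u - w) ^ Suc N \<le> cmod (Q m u)" for m
    using far_critical_root_near_unity[OF far _ _ u] \<beta>[of m] by simp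
  then obtain w where w: "\<And>m. w m ^ Suc N - 1 + Q m (w m) = 0" "\<And>m. cmod (w m) \<le> 1"
      "\<And>m. cmod (u - w m) ^ Suc N \<le> cmod (Q m u)"
    by metis
  have "(\<lambda>m. root (Suc N) (cmod (Q m u))) \<longlonglongrightarrow> root (Suc N) (cmod 0)"
    by (intro tendsto_real_root tendsto_norm perturbation_lim)
  then have "(\<lambda>m. root (Suc N) (cmod (Q m u))) \<longlonglongrightarrow> 0" by simp
  moreover have "cmod (u - w m) \<le> root (Suc N) (cmod (Q m u))" for m
    using real_root_le_mono[OF _ w(3)[of m], of "Suc N"]
      real_root_power_cancel[of "Suc N" "cmod (u - w m)"] by (simp del: power_Suc)
  ultimately have "(\<lambda>m. u - w m) \<longlonglongrightarrow> 0"
    by (intro Lim_null_comparison[of "\<lambda>m. u - w m" "\<lambda>m. root (Suc N) (cmod (Q m u))"]) auto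
  from tendsto_diff[OF tendsto_const[of u] this] have "w \<longlonglongrightarrow> u" by simp
  then show ?thesis using that perturbation_nonneg[OF w(1,2)] by blast
qed

lemma unity_power_N:
  assumes "u ^ Suc N = 1"
  shows "u ^ N = cnj u" "u ^ Suc p = (cnj u)\<^sup>2" "cmod u = 1"
proof -
  have "cmod u ^ Suc N = 1" unfolding norm_power[symmetric] assms by simp
  then show 1: "cmod u = 1" using power_eq_imp_eq_base[of "cmod u" "Suc N" 1] by simp
  then have c: "u * cnj u = 1" by (simp add: complex_norm_square[symmetric])
  have "u ^ N = u ^ N * (u * cnj u)" unfolding c by simp
  also have "\<dots> = u ^ Suc N * cnj u" by simp
  finally show N: "u ^ N = cnj u" unfolding assms by simp
  have "u ^ Suc p = u ^ Suc p * (u * cnj u)" unfolding c by simp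
  also have "\<dots> = u ^ N * cnj u" by simp
  finally show "u ^ Suc p = (cnj u)\<^sup>2" unfolding N by (simp add: power2_eq_square)
qed

lemma unity_cnj: "u ^ Suc N = 1 \<Longrightarrow> cnj u ^ Suc N = 1"
  by (metis complex_cnj_one complex_cnj_power)

text \<open>
  Without this the imaginary parts would dominate: the inequality at \<open>u\<close> and at its conjugate have
  opposite signs, which forces the sum of the \<open>\<eta> k\<close> to vanish.
\<close>

lemma sum_\<eta>_le:
  assumes u: "u ^ Suc N = 1"
  shows "(\<Sum>k<N. \<eta> k) * Im u \<le> 0"
proof -
  obtain w where w: "w \<longlonglongrightarrow> u" "\<And>m. 0 \<le> Re (Q m (w m))"
    using near_root_sequence[OF u] by blast
  let ?L = "of_nat (Suc N) / of_nat N * (- (\<i> * of_real (\<Sum>k<N. \<eta> k))) * (u ^ N - 1)"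
  have "(\<lambda>m. Re (Q m (w m) / of_real (h m))) \<longlonglongrightarrow> Re ?L"
    by (intro tendsto_Re perturbation_over_h w)
  moreover have "0 \<le> Re (Q m (w m) / of_real (h m))" for m
    using w(2)[of m] h_pos[of m] by simp
  ultimately have "0 \<le> Re ?L" by (intro LIMSEQ_le_const) auto
  also have "?L = of_real (real (Suc N) / real N) * (- (\<i> * of_real (\<Sum>k<N. \<eta> k)) * (u ^ N - 1))"
    by simp
  also have "Re \<dots> = real (Suc N) / real N * - ((\<Sum>k<N. \<eta> k) * Im u)"
    unfolding unity_power_N(1)[OF u] by (simp add: algebra_simps del: of_nat_Suc sum.lessThan_Suc)
  finally show ?thesis
    by (simp add: mult_le_0_iff zero_le_mult_iff divide_simps del: of_nat_Suc sum.lessThan_Suc)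
qed

lemma sum_\<eta>_zero: "(\<Sum>k<N. \<eta> k) = 0"
proof -
  obtain u where u: "u ^ Suc N = 1" "0 < Im u" using ex_unity_Im_pos by blast
  from sum_\<eta>_le[OF u(1)] sum_\<eta>_le[OF unity_cnj[OF u(1)]] show ?thesis
    using u(2) by (simp add: mult_le_0_iff zero_le_mult_iff del: sum.lessThan_Suc)
qed

text \<open>
  Since the sum of the \<open>\<eta> k\<close> vanishes, the sum of the imaginary parts is \<open>o(h)\<close>; it turns out to be of
  order \<open>h^2\<close>, and \<open>b\<close> is its value at this scale. Its boundedness is a result and not part of the
  set-up, because it comes from the signs of the first order inequalities.
\<close>

definition b :: "nat \<Rightarrow> real" where "b m = (\<Sum>k<N. Im (\<zeta> m k)) / (h m)\<^sup>2"

definition a :: real where "a = (\<Sum>k<N. \<xi> k)"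

definition S :: real where "S = (\<Sum>k<N. (\<eta> k)\<^sup>2)"

lemma S_nonneg: "0 \<le> S" unfolding S_def by (intro sum_nonneg) simp

lemma coeff_e2_lim: "coeff (root_prod N (\<lambda>k. \<i> * of_real (\<eta> k))) p = of_real (S / 2)"
proof -
  have "(\<Sum>k<N. \<i> * of_real (\<eta> k)) = \<i> * of_real (\<Sum>k<N. \<eta> k)"
    unfolding of_real_sum sum_distrib_left ..
  then have "2 * coeff (root_prod N (\<lambda>k. \<i> * of_real (\<eta> k))) p = - (\<Sum>k<N. (\<i> * of_real (\<eta> k))\<^sup>2)"
    unfolding coeff_root_prod_e2 sum_\<eta>_zero by simp
  also have "\<dots> = of_real S"
    unfolding S_def of_real_sum sum_negf[symmetric] by (simp add: power_mult_distrib)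
  finally show ?thesis unfolding of_real_divide by (simp add: eq_divide_eq mult.commute)
qed

text \<open>
  The inequality \<open>Re (Q m (w m)) \<ge> 0\<close> at the root nearest to \<open>u\<close>, divided by \<open>(1 - \<beta>) * (N + 1)\<close>. The
  term with \<open>b\<close> is kept apart, since nothing is known about the size of \<open>b\<close> here.
\<close>

lemma first_order_sequence:
  assumes u: "u ^ Suc N = 1"
  obtains A I where "A \<longlonglongrightarrow> 1 + a / real N * (1 - Re u) - S / real (Suc p) * (1 - (Re u)\<^sup>2)"
    "I \<longlonglongrightarrow> - Im u / real N" "\<And>m. 0 \<le> A m + b m * I m"
proof -
  obtain w where w: "w \<longlonglongrightarrow> u" "\<And>m. 0 \<le> Re (Q m (w m))"
    using near_root_sequence[OF u] by blast
  define e where "e m = complex_of_real ((h m)\<^sup>2)" for m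
  define D where "D m k = w m ^ Suc k - of_real (\<beta> m) ^ Suc k" for m k
  define F where "F m k = coeff (root_prod N (\<zeta> m)) k / e m" for m k
  let ?c = "\<lambda>k. of_nat (Suc N) / of_nat (Suc k) :: complex"
  define Rest where "Rest m = (1 - of_real (\<beta> m) ^ Suc N) / e m + (\<Sum>k<p. ?c k * F m k * D m k)
      + ?c p * F m p * D m p" for m
  have e0: "e m \<noteq> 0" for m using h_pos[of m] by (simp add: e_def)
  have Q_eq: "Q m (w m) / e m = Rest m + ?c (Suc p) * F m (Suc p) * D m (Suc p)" for m
    unfolding perturbation_def add_divide_distrib sum_divide_distrib sum.lessThan_Suc Rest_def F_def D_def
    by (simp only: add.assoc times_divide_eq_right times_divide_eq_left)
  have D_lim: "(\<lambda>m. D m k) \<longlonglongrightarrow> u ^ Suc k - 1" for k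
    unfolding D_def using tendsto_diff[OF tendsto_power[OF w(1), of "Suc k"] tendsto_power[OF tendsto_of_real[OF \<beta>_lim], of "Suc k"]]
    by (simp del: power_Suc)
  have F_small: "(\<lambda>m. F m k) \<longlonglongrightarrow> 0" if "k < p" for k
    using coeff_small[of k 2] that by (simp add: F_def e_def)
  have F_p: "(\<lambda>m. F m p) \<longlonglongrightarrow> of_real (S / 2)"
    using coeff_lim[of p] unfolding coeff_e2_lim F_def e_def by (simp add: numeral_2_eq_2)
  have "(\<lambda>m. of_real ((1 - \<beta> m ^ Suc N) / (h m)\<^sup>2)) \<longlonglongrightarrow> complex_of_real (real (Suc N))"
    by (intro tendsto_of_real one_minus_power_lim)
  then have first: "(\<lambda>m. (1 - of_real (\<beta> m) ^ Suc N) / e m) \<longlonglongrightarrow> of_nat (Suc N)"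
    by (simp add: e_def del: power_Suc of_nat_Suc)
  have "Rest \<longlonglongrightarrow> of_nat (Suc N) + (\<Sum>k<p. ?c k * 0 * (u ^ Suc k - 1)) + ?c p * of_real (S / 2) * (u ^ Suc p - 1)"
    unfolding Rest_def
    by (intro tendsto_add tendsto_sum tendsto_mult first D_lim F_p F_small tendsto_const) auto
  then have Rest_lim: "Rest \<longlonglongrightarrow> of_nat (Suc N) + ?c p * of_real (S / 2) * ((cnj u)\<^sup>2 - 1)"
    unfolding unity_power_N(2)[OF u] by (simp del: of_nat_Suc)
  define x where "x m = (\<Sum>k<N. Re (\<zeta> m k)) / (h m)\<^sup>2" for m
  have x_lim: "x \<longlonglongrightarrow> a"
    unfolding x_def a_def sum_divide_distrib by (intro tendsto_sum Re_lim) simp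
  have "F m (Suc p) = - (of_real (x m) + \<i> * of_real (b m))" for m
    unfolding F_def coeff_root_prod_e1 e_def x_def b_def
    by (simp add: complex_eq_iff sum_divide_distrib[symmetric] del: sum.lessThan_Suc)
  then have Q_eq': "Q m (w m) / e m = Rest m - ?c (Suc p) * (of_real (x m) + \<i> * of_real (b m)) * D m (Suc p)" for m
    unfolding Q_eq by (simp only: mult_minus_left mult_minus_right add_uminus_conv_diff)
  define t :: real where "t = real (Suc N)"
  define g where "g = t / real N"
  have t: "0 < t" by (simp add: t_def)
  have c_eq: "?c (Suc p) = of_real g" by (simp add: g_def t_def)
  have Re_eq: "Re (Q m (w m) / e m) = (Re (Rest m) - g * x m * Re (D m (Suc p))) + b m * (g * Im (D m (Suc p)))" for m
    unfolding Q_eq' c_eq by (simp add: algebra_simps)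
  define A where "A m = (Re (Rest m) - g * x m * Re (D m (Suc p))) / t" for m
  define I where "I m = g * Im (D m (Suc p)) / t" for m
  have DN: "(\<lambda>m. D m (Suc p)) \<longlonglongrightarrow> cnj u - 1" using D_lim[of "Suc p"] unfolding unity_power_N(1)[OF u] .
  have "A \<longlonglongrightarrow> (Re (of_nat (Suc N) + ?c p * of_real (S / 2) * ((cnj u)\<^sup>2 - 1)) - g * a * Re (cnj u - 1)) / t"
    unfolding A_def using t by (intro tendsto_intros Rest_lim x_lim DN) auto
  moreover have "(Re (of_nat (Suc N) + ?c p * of_real (S / 2) * ((cnj u)\<^sup>2 - 1)) - g * a * Re (cnj u - 1)) / t
     = 1 + a / real N * (1 - Re u) - S / real (Suc p) * (1 - (Re u)\<^sup>2)"
  proof -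
    have "(Re u)\<^sup>2 + (Im u)\<^sup>2 = 1" using unity_power_N(3)[OF u] by (metis cmod_power2 one_power2)
    then have sq: "Re ((cnj u)\<^sup>2 - 1) = - 2 * (1 - (Re u)\<^sup>2)" by (simp add: power2_eq_square)
    have c_p: "?c p * of_real (S / 2) * ((cnj u)\<^sup>2 - 1) = of_real (t / real (Suc p) * (S / 2)) * ((cnj u)\<^sup>2 - 1)"
      by (simp add: t_def)
    have pull: "Re (of_real r * v) = r * Re v" for r v by simp
    have "t / y * (S / 2) * (- 2 * q) = - t * (S / y * q)" for y q by simp
    then have "Re (?c p * of_real (S / 2) * ((cnj u)\<^sup>2 - 1)) = - t * (S / real (Suc p) * (1 - (Re u)\<^sup>2))"
      unfolding c_p pull sq .
    moreover have "Re (of_nat (Suc N) :: complex) = t" by (simp add: t_def)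
    moreover have "(t + - t * q - t / y * a * (x - 1)) / t = 1 + a / y * (1 - x) - q" for q x y
      using t by (simp add: diff_divide_distrib add_divide_distrib) (simp add: algebra_simps diff_divide_distrib)
    moreover have "Re (cnj u - 1) = Re u - 1" by simp
    ultimately show ?thesis unfolding g_def by (simp only: plus_complex.simps)
  qed
  moreover have "I \<longlonglongrightarrow> g * Im (cnj u - 1) / t" unfolding I_def using t by (intro tendsto_intros DN) auto
  moreover have "g * Im (cnj u - 1) / t = - Im u / real N" using t by (simp add: g_def)
  moreover have "0 \<le> A m + b m * I m" for m
  proof -
    have "0 \<le> Re (Q m (w m) / e m)"
      using w(2)[of m] h_pos[of m] unfolding e_def Re_divide_of_real by simp
    then show ?thesis unfolding Re_eq A_def I_def using t by (simp add: field_simps)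
  qed
  ultimately show ?thesis using that by simp
qed

text \<open>
  A root of unity with positive imaginary part bounds \<open>b\<close> from above, its conjugate from below.
\<close>

lemma b_bounded: "Bseq b"
proof -
  have bound: "\<exists>C. \<forall>m. s * b m \<le> C" if s: "s = 1 \<or> s = - 1" for s
  proof -
    obtain u0 where u0: "u0 ^ Suc N = 1" "0 < Im u0" using ex_unity_Im_pos by blast
    define u where "u = (if s = 1 then u0 else cnj u0)"
    have u: "u ^ Suc N = 1" "0 < s * Im u" using u0 unity_cnj[OF u0(1)] s by (auto simp: u_def)
    from first_order_sequence[OF u(1)] obtain A I l where AI: "A \<longlonglongrightarrow> l" "I \<longlonglongrightarrow> - Im u / real N"
      "\<And>m. 0 \<le> A m + b m * I m" by metis
    have "(\<lambda>m. - s * I m) \<longlonglongrightarrow> - s * (- Im u / real N)" by (intro tendsto_intros AI)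
    moreover define d where "d = s * Im u / (2 * real N)"
    moreover have d: "0 < d" using u(2) by (simp add: d_def)
    moreover have "d < - s * (- Im u / real N)"
    proof -
      have "- s * (- Im u / y) = 2 * (s * Im u / (2 * y))" for y by simp
      then have "- s * (- Im u / real N) = 2 * d" unfolding d_def .
      then show ?thesis using d by linarith
    qed
    ultimately have "eventually (\<lambda>m. d < - s * I m) sequentially" by (metis order_tendstoD(1))
    then obtain M where M: "\<And>m. m \<ge> M \<Longrightarrow> d < - s * I m" unfolding eventually_sequentially by blast
    obtain K where K: "0 < K" "\<And>m. norm (A m) \<le> K" using convergent_imp_Bseq[OF convergentI[OF AI(1)]] by (metis BseqE)
    have "s * b m \<le> K / d" if "m \<ge> M" for m
    proof (rule ccontr)
      assume "\<not> s * b m \<le> K / d"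
      then have "K < s * b m * d" using d by (simp add: field_simps)
      moreover have "0 < s * b m" using calculation d K(1) by (smt (verit) zero_less_mult_pos2)
      then have "s * b m * d < s * b m * (- s * I m)" using M[OF that] by (intro mult_strict_left_mono)
      moreover have "s * b m * (- s * I m) = - (b m * I m)" using s by auto
      ultimately have "K < - (b m * I m)" by linarith
      then show False using AI(3)[of m] K(2)[of m] unfolding real_norm_def by linarith
    qed
    moreover have "s * b m \<le> Max ((\<lambda>m. s * b m) ` {..<M})" if "m < M" for m
      using that by (intro Max_ge) auto
    ultimately have "\<forall>m. s * b m \<le> max (K / d) (Max ((\<lambda>m. s * b m) ` {..<M}))"
      by (metis le_max_iff_disj linorder_not_less)
    then show ?thesis by blast
  qed
  obtain C1 where C1: "\<And>m. 1 * b m \<le> C1" using bound[of 1] by blast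
  obtain C2 where C2: "\<And>m. - 1 * b m \<le> C2" using bound[of "- 1"] by blast
  have "norm (b m) \<le> max C1 C2" for m using C1[of m] C2[of m] by auto
  then show ?thesis by (rule BseqI')
qed

text \<open>
  The limit of the inequalities: \<open>a\<close> is the first order drift of the centroid of the critical
  points and \<open>S\<close> measures their imaginary spread.
\<close>

lemma first_order_condition:
  assumes "b \<longlonglongrightarrow> B" "u ^ Suc N = 1"
  shows "0 \<le> 1 + a / real N * (1 - Re u) - B / real N * Im u - S / real (Suc p) * (1 - (Re u)\<^sup>2)"
proof -
  obtain A I where AI: "A \<longlonglongrightarrow> 1 + a / real N * (1 - Re u) - S / real (Suc p) * (1 - (Re u)\<^sup>2)"
    "I \<longlonglongrightarrow> - Im u / real N" "\<And>m. 0 \<le> A m + b m * I m"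
    using first_order_sequence[OF assms(2)] by metis
  have "(\<lambda>m. A m + b m * I m) \<longlonglongrightarrow>
     1 + a / real N * (1 - Re u) - S / real (Suc p) * (1 - (Re u)\<^sup>2) + B * (- Im u / real N)"
    by (intro tendsto_intros AI assms)
  then have "0 \<le> 1 + a / real N * (1 - Re u) - S / real (Suc p) * (1 - (Re u)\<^sup>2) + B * (- Im u / real N)"
    by (rule LIMSEQ_le_const) (use AI(3) in blast)
  then show ?thesis by simp
qed

text \<open>
  The first order form of the distance condition. The radius is \<open>1 - 3/10 (1 - \<beta>)\<close> to first order
  and \<open>\<beta>\<close> itself is \<open>1 - (1 - \<beta>)\<close>, which leaves \<open>7/10\<close>; a critical point off the real axis may be
  further right by half the square of its imaginary part.
\<close>

lemma \<xi>_le: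
  assumes "k < N"
  shows "\<xi> k \<le> - 7 / 10 + (\<eta> k)\<^sup>2 / 2"
proof -
  define e where "e m = 1 - \<beta> m" for m
  define r where "r m = 1 - 3 / 10 * \<beta> m * (1 - \<beta> m)" for m
  have e: "0 < e m" "e m = (h m)\<^sup>2" for m using \<beta>[of m] h_sq[of m] by (simp_all add: e_def)
  have "0 \<le> - (2 * \<beta> m * (Re (\<zeta> m k) / (h m)\<^sup>2)) + (- 1 + 3 / 10 * \<beta> m) * (\<beta> m + r m)
      + (h m)\<^sup>2 * (Re (\<zeta> m k) / (h m)\<^sup>2)\<^sup>2 + (Im (\<zeta> m k) / h m)\<^sup>2" for m
  proof -
    have "r m < cmod (\<zeta> m k - of_real (\<beta> m))"
      using far[of m] assms unfolding far_critical_def r_def by blast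
    moreover have "0 \<le> r m" using radius_bounds[of "\<beta> m"] \<beta>[of m] by (simp add: r_def)
    ultimately have "(r m)\<^sup>2 \<le> (cmod (\<zeta> m k - of_real (\<beta> m)))\<^sup>2" by (intro power_mono) auto
    then have "0 \<le> (Re (\<zeta> m k) - \<beta> m)\<^sup>2 + (Im (\<zeta> m k))\<^sup>2 - (r m)\<^sup>2" by (simp add: cmod_power2)
    then have "0 \<le> ((Re (\<zeta> m k) - \<beta> m)\<^sup>2 + (Im (\<zeta> m k))\<^sup>2 - (r m)\<^sup>2) / e m"
      using e(1)[of m] by simp
    also have "(Re (\<zeta> m k) - \<beta> m)\<^sup>2 + (Im (\<zeta> m k))\<^sup>2 - (r m)\<^sup>2
        = - (2 * \<beta> m * Re (\<zeta> m k)) + (- 1 + 3 / 10 * \<beta> m) * (\<beta> m + r m) * e m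
          + (Re (\<zeta> m k))\<^sup>2 + (Im (\<zeta> m k))\<^sup>2"
      unfolding r_def e_def by (simp add: power2_eq_square field_simps)
    finally show ?thesis using e(1)[of m] h_pos[of m] unfolding e(2)
      by (simp add: add_divide_distrib diff_divide_distrib power_divide power2_eq_square)
  qed
  moreover have "(\<lambda>m. - (2 * \<beta> m * (Re (\<zeta> m k) / (h m)\<^sup>2)) + (- 1 + 3 / 10 * \<beta> m) * (\<beta> m + r m)
      + (h m)\<^sup>2 * (Re (\<zeta> m k) / (h m)\<^sup>2)\<^sup>2 + (Im (\<zeta> m k) / h m)\<^sup>2)
     \<longlonglongrightarrow> - (2 * 1 * \<xi> k) + (- 1 + 3 / 10 * 1) * (1 + (1 - 3 / 10 * 1 * (1 - 1))) + 0\<^sup>2 * (\<xi> k)\<^sup>2 + (\<eta> k)\<^sup>2"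
    unfolding r_def by (intro tendsto_intros \<beta>_lim h_lim Re_lim Im_lim assms)
  ultimately have "0 \<le> - (2 * 1 * \<xi> k) + (- 1 + 3 / 10 * 1) * (1 + (1 - 3 / 10 * 1 * (1 - 1))) + 0\<^sup>2 * (\<xi> k)\<^sup>2 + (\<eta> k)\<^sup>2"
    by (intro LIMSEQ_le_const) auto
  then show ?thesis by simp
qed

end

section \<open>First order contradiction for degrees other than five\<close>

lemma abs_cos_diff_le: "\<bar>cos x - cos y\<bar> \<le> \<bar>x - y\<bar>" for x y :: real
proof -
  have "\<bar>cos x - cos y\<bar> = 2 * (\<bar>sin ((x + y) / 2)\<bar> * \<bar>sin ((y - x) / 2)\<bar>)"
    by (simp add: cos_diff_cos abs_mult)
  also have "\<dots> \<le> 2 * (1 * \<bar>(y - x) / 2\<bar>)"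
    by (intro mult_left_mono mult_mono abs_sin_x_le_abs_x) auto
  finally show ?thesis by simp
qed

text \<open>
  Two roots of unity whose real parts enclose \<open>- 43/100\<close> and are close to each other. This value
  lies just left of \<open>- 3/7\<close>, where \<open>3/10 + 7/10 c\<close> changes sign. For degree at least 7 two consecutive
  angles will do, because their cosines differ by at most \<open>2 * pi / n\<close>; small degrees are explicit.
  For degree 5, which is excluded, the neighbouring pair at angles \<open>2 * pi / 5\<close> and \<open>4 * pi / 5\<close> is too
  far apart.
\<close>

lemma unity_grid:
  assumes "p \<noteq> 2"
  shows "\<exists>u v. u ^ Suc (Suc (Suc p)) = 1 \<and> v ^ Suc (Suc (Suc p)) = 1 \<and>
    Re v \<le> - 43 / 100 \<and> - 43 / 100 \<le> Re u \<and>
    (Re u + 43 / 100) * (- 43 / 100 - Re v) \<le> 143 / 100 * (57 / 100 - real (Suc p) / (2 * real (Suc (Suc p))))"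
proof -
  have cis3: "cis (2 * pi / 3) = Complex (- 1 / 2) (sqrt 3 / 2)"
    by (simp add: complex_eq_iff cos_120 sin_120)
  have cis6: "cis (pi / 3) = Complex (1 / 2) (sqrt 3 / 2)"
    by (simp add: complex_eq_iff cos_60 sin_60)
  have unity3: "cis (2 * pi / 3) ^ 3 = 1" unfolding Complex.DeMoivre by simp
  consider "p = 0" | "p = 1" | "p = 3" | "4 \<le> p" using assms by linarith
  then show ?thesis
  proof cases
    case 1
    then show ?thesis using unity3
      by (intro exI[of _ 1] exI[of _ "cis (2 * pi / 3)"]) (simp add: cis3 numeral_3_eq_3)
  next
    case 2
    then show ?thesis by (intro exI[of _ \<i>] exI[of _ "- 1"]) simp
  next
    case 3
    have "cis (pi / 3) ^ 6 = 1" unfolding Complex.DeMoivre by simp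
    moreover have "cis (2 * pi / 3) ^ 6 = 1"
      using arg_cong[OF unity3, of "\<lambda>x. x\<^sup>2"] by (simp flip: power_mult)
    ultimately show ?thesis using 3
      by (intro exI[of _ "cis (pi / 3)"] exI[of _ "cis (2 * pi / 3)"]) (simp add: cis3 cis6 eval_nat_numeral)
  next
    case 4
    define n where "n = Suc (Suc (Suc p))"
    have n: "7 \<le> n" using 4 by (simp add: n_def)
    define \<theta> where "\<theta> j = 2 * pi * real j / real n" for j
    have unity: "cis (\<theta> j) ^ n = 1" for j
    proof -
      have "cis (\<theta> j) ^ n = cis (real n * \<theta> j)" by (rule Complex.DeMoivre)
      also have "real n * \<theta> j = 2 * pi * real j" using n by (simp add: \<theta>_def)
      also have "cis (2 * pi * real j) = 1" by (rule cis_multiple_2pi) simp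
      finally show ?thesis .
    qed
    have "cos (\<theta> (n div 2)) < - 43 / 100"
    proof -
      have "real n - 1 \<le> 2 * real (n div 2)" "2 * real (n div 2) \<le> real n" by linarith+
      moreover have half: "\<theta> (n div 2) = pi * (2 * real (n div 2) / real n)" by (simp add: \<theta>_def)
      moreover have "2 / 3 \<le> (real n - 1) / real n" using n by (simp add: field_simps)
      ultimately have "2 / 3 \<le> 2 * real (n div 2) / real n" "2 * real (n div 2) / real n \<le> 1"
        using n by (simp_all add: field_simps)
      then have "pi * (2 / 3) \<le> \<theta> (n div 2)" "\<theta> (n div 2) \<le> pi * 1"
        unfolding half by (intro mult_left_mono; simp)+
      then have "cos (\<theta> (n div 2)) \<le> cos (2 * pi / 3)" by (intro cos_monotone_0_pi_le) auto
      then show ?thesis by (simp add: cos_120)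
    qed
    then obtain j where j: "cos (\<theta> j) < - 43 / 100" "\<And>i. i < j \<Longrightarrow> \<not> cos (\<theta> i) < - 43 / 100"
      using exists_least_iff[of "\<lambda>j. cos (\<theta> j) < - 43 / 100"] by auto
    have "j \<noteq> 0" using j(1) by (intro notI) (simp add: \<theta>_def)
    then obtain i where i: "j = Suc i" by (cases j) auto
    define x where "x = cos (\<theta> i) + 43 / 100"
    define y where "y = - 43 / 100 - cos (\<theta> j)"
    have xy: "0 \<le> x" "0 \<le> y" using j(1) j(2)[of i] i by (auto simp: x_def y_def)
    have "x + y \<le> \<bar>\<theta> i - \<theta> j\<bar>"
      unfolding x_def y_def using abs_cos_diff_le[of "\<theta> i" "\<theta> j"] by linarith
    also have "\<theta> i - \<theta> j = - (2 * pi / real n)" using n by (simp add: \<theta>_def i field_simps)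
    finally have sum: "x + y \<le> 2 * pi / real n" by simp
    \<comment> \<open>The gap enters only quadratically, because \<open>- 43/100\<close> lies between the two cosines.\<close>
    have "4 * (x * y) \<le> (x + y)\<^sup>2" using zero_le_power2[of "x - y"] by (simp add: power2_eq_square algebra_simps)
    also have "\<dots> \<le> (2 * pi / real n)\<^sup>2" by (rule power_mono) (use sum xy in auto)
    also have "\<dots> \<le> (2 * (63 / 20) / real n)\<^sup>2"
      using pi_approx(2) by (intro power_mono divide_right_mono mult_left_mono) auto
    finally have xy_le: "x * y \<le> (63 / 20)\<^sup>2 / (real n)\<^sup>2" by (simp add: power_divide power_mult_distrib)
    have "(63 / 20)\<^sup>2 / (real n)\<^sup>2 \<le> 143 / 100 * (57 / 100 - real (Suc p) / (2 * real (Suc (Suc p))))"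
    proof -
      define t where "t = real n - 7"
      have t: "0 \<le> t" "real n = t + 7" "real (Suc p) = t + 5" "real (Suc (Suc p)) = t + 6"
        using n unfolding t_def n_def by auto
      have "(t + 8) * (2 * (t + 6)) \<le> 2 * (t + 7)\<^sup>2" by (simp add: power2_eq_square algebra_simps)
      then have "(t + 8) \<le> 2 * (t + 7)\<^sup>2 / (2 * (t + 6))" using t(1) by (intro mult_imp_le_div_pos) auto
      then have "(t + 8) / (2 * (t + 7)\<^sup>2) \<le> 1 / (2 * (t + 6))"
        using t(1) by (intro mult_imp_div_pos_le) auto
      also have "1 / (2 * (t + 6)) = 1 / 2 - (t + 5) / (2 * (t + 6))"
        using t(1) by (simp add: field_simps)
      finally have *: "7 / 100 + (t + 8) / (2 * (t + 7)\<^sup>2) \<le> 57 / 100 - (t + 5) / (2 * (t + 6))" by simp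
      have "143 / 100 * (7 / 100 * (t + 7)\<^sup>2 + (t + 8) / 2)
          = (63 / 20)\<^sup>2 + (439 / 625 + (1001 / 10000 * (t * t) + 5291 / 2500 * t))"
        by (simp add: power2_eq_square field_simps)
      then have "(63 / 20)\<^sup>2 \<le> 143 / 100 * (7 / 100 * (t + 7)\<^sup>2 + (t + 8) / 2)"
        using t(1) by simp
      then have "(63 / 20)\<^sup>2 / (t + 7)\<^sup>2 \<le> 143 / 100 * (7 / 100 * (t + 7)\<^sup>2 + (t + 8) / 2) / (t + 7)\<^sup>2"
        by (rule divide_right_mono) simp
      also have "\<dots> = 143 / 100 * (7 / 100 + (t + 8) / (2 * (t + 7)\<^sup>2))"
        using t(1) by (simp add: add_divide_distrib)
      also have "\<dots> \<le> 143 / 100 * (57 / 100 - (t + 5) / (2 * (t + 6)))"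
        by (rule mult_left_mono[OF *]) simp
      finally show ?thesis unfolding t(2-4) .
    qed
    then have "x * y \<le> 143 / 100 * (57 / 100 - real (Suc p) / (2 * real (Suc (Suc p))))"
      using xy_le by linarith
    then show ?thesis using unity[of i] unity[of j] xy unfolding n_def x_def y_def
      by (intro exI[of _ "cis (\<theta> i)"] exI[of _ "cis (\<theta> j)"]) (simp del: power_Suc of_nat_Suc)
  qed
qed

context far_critical_limit
begin

lemma a_eq: "a = - 7 / 10 * real N + S / 2 - (\<Sum>k<N. - 7 / 10 + (\<eta> k)\<^sup>2 / 2 - \<xi> k)"
proof -
  have "(\<Sum>k<N. - 7 / 10 + (\<eta> k)\<^sup>2 / 2 - \<xi> k) = - 7 / 10 * real N + S / 2 - a"
    unfolding sum_subtractf sum.distrib S_def a_def sum_divide_distrib by simp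
  then show ?thesis by simp
qed

lemma a_le: "a \<le> - 7 / 10 * real N + S / 2"
proof -
  have "0 \<le> (\<Sum>k<N. - 7 / 10 + (\<eta> k)\<^sup>2 / 2 - \<xi> k)"
    by (intro sum_nonneg) (use \<xi>_le in \<open>auto simp: algebra_simps\<close>)
  then show ?thesis using a_eq by linarith
qed

text \<open>
  The conditions at \<open>u\<close> and at its conjugate together.
\<close>

lemma first_order_condition_real:
  assumes "b \<longlonglongrightarrow> B" "u ^ Suc N = 1"
  shows "\<bar>B / real N * Im u\<bar> \<le> 1 + a / real N * (1 - Re u) - S / real (Suc p) * (1 - (Re u)\<^sup>2)"
  using first_order_condition[OF assms] first_order_condition[OF assms(1) unity_cnj[OF assms(2)]]
  by (simp add: abs_le_iff del: of_nat_Suc)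

text \<open>
  Eliminating \<open>a\<close> turns the first order condition into \<open>f c \<ge> 0\<close> for a quadratic \<open>f\<close>, evaluated at
  cosines \<open>c\<close> of the angles of roots of unity. In general a single cosine is not enough, since the condition at it may hold for a suitable value of
  the unknown spread \<open>\<sigma>\<close>. Interpolating linearly between two cosines around \<open>m\<close> removes this freedom: the value of the chord at
  \<open>m\<close> is \<open>f m + \<sigma> * (Re u - m) * (m - Re v)\<close>, and for close cosines the coefficient of \<open>\<sigma>\<close> in it is not positive.
\<close>

lemma degree_5:
  assumes "b \<longlonglongrightarrow> B"
  shows "p = 2"
proof (rule ccontr)
  assume "p \<noteq> 2"
  define m \<kappa> \<sigma> :: real where "m = - 43 / 100" and "\<kappa> = real (Suc p) / (2 * real N)"
    and "\<sigma> = S / real (Suc p)"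
  define f where "f c = 3 / 10 + 7 / 10 * c + \<sigma> * ((1 - c) * (\<kappa> - 1 - c))" for c
  have \<sigma>: "0 \<le> \<sigma>" using S_nonneg by (simp add: \<sigma>_def)
  have f_nonneg: "0 \<le> f (Re u)" if u: "u ^ Suc N = 1" for u
  proof -
    have "Re u \<le> 1" using complex_Re_le_cmod[of u] unity_power_N(3)[OF u] by simp
    then have "a / real N * (1 - Re u) \<le> (- 7 / 10 * real N + S / 2) / real N * (1 - Re u)"
      by (intro mult_right_mono divide_right_mono a_le) auto
    moreover have "0 \<le> 1 + a / real N * (1 - Re u) - S / real (Suc p) * (1 - (Re u)\<^sup>2)"
      using first_order_condition_real[OF assms u] by linarith
    moreover have "(- 7 / 10 * real N + S / 2) / real N = - 7 / 10 + \<sigma> * \<kappa>"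
    proof -
      have *: "(- 7 / 10 * y + S / 2) / y = - 7 / 10 + S / x * (x / (2 * y))" if "0 < x" "0 < y" for x y
        using that by (simp add: field_simps)
      show ?thesis unfolding \<sigma>_def \<kappa>_def by (rule *) simp_all
    qed
    ultimately have "0 \<le> 1 + (- 7 / 10 + \<sigma> * \<kappa>) * (1 - Re u) - \<sigma> * (1 - (Re u)\<^sup>2)"
      unfolding \<sigma>_def[symmetric] by (simp only:)
    also have "\<dots> = f (Re u)" by (simp add: f_def power2_eq_square field_simps)
    finally show ?thesis .
  qed
  obtain u v where uv: "u ^ Suc N = 1" "v ^ Suc N = 1" "Re v \<le> m" "m \<le> Re u"
    "(Re u - m) * (m - Re v) \<le> (1 - m) * (1 + m - \<kappa>)"
    using unity_grid[OF \<open>p \<noteq> 2\<close>] unfolding m_def \<kappa>_def by auto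
  have neg: "f m + \<sigma> * ((Re u - m) * (m - Re v)) < 0"
  proof -
    have "\<sigma> * ((Re u - m) * (m - Re v)) \<le> \<sigma> * ((1 - m) * (1 + m - \<kappa>))"
      by (rule mult_left_mono[OF uv(5) \<sigma>])
    moreover have "f m = - 1 / 1000 - \<sigma> * ((1 - m) * (1 + m - \<kappa>))"
      by (simp add: f_def m_def field_simps)
    ultimately show ?thesis by linarith
  qed
  have "(m - Re v) * f (Re u) + (Re u - m) * f (Re v)
      = (Re u - Re v) * (f m + \<sigma> * ((Re u - m) * (m - Re v)))"
    by (simp add: f_def field_simps)
  moreover have "0 \<le> (m - Re v) * f (Re u) + (Re u - m) * f (Re v)"
    using uv f_nonneg by simp
  ultimately have "\<not> 0 < Re u - Re v"
    using mult_pos_neg[of "Re u - Re v", OF _ neg] by linarith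
  then have "Re u = m" "Re v = m" using uv by auto
  then show False using f_nonneg[OF uv(1)] neg by simp
qed

section \<open>First order rigidity in degree five\<close>

text \<open>
  In degree five the two cosines \<open>c\<close> and \<open>c'\<close> are the roots of \<open>4 c^2 + 2 c - 1\<close>, and the combination of
  the two first order conditions with the positive weights \<open>3 - 2 c\<close> and \<open>3 - 2 c'\<close> cancels exactly.
  So there is no contradiction at first order, but all inequalities are equalities: to first
  order every critical point lies on the circle of the extremal radius, and \<open>S\<close> and \<open>B\<close> are determined.
\<close>

lemma quintic_rigid:
  assumes "p = 2" "b \<longlonglongrightarrow> B"
  shows "S = 12 / 5" "B = 0" "\<And>k. k < 4 \<Longrightarrow> \<xi> k = - 7 / 10 + (\<eta> k)\<^sup>2 / 2"
proof -
  have N: "N = 4" "real N = 4" "real (Suc p) = 3" using assms(1) by simp_all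
  obtain u where u: "u ^ Suc N = 1" "0 < Im u" using ex_unity_Im_pos by blast
  define c where "c = Re u"
  define g where "g x = 1 + a / 4 * (1 - x) - S / 3 * (1 - x\<^sup>2)" for x
  have circle: "c\<^sup>2 + (Im u)\<^sup>2 = 1" unfolding c_def using unity_power_N(3)[OF u(1)] by (metis cmod_power2 one_power2)
  have u2: "(u\<^sup>2) ^ Suc N = 1"
  proof -
    have "(u\<^sup>2) ^ Suc N = u ^ (2 * Suc N)" by (rule power_mult[symmetric])
    also have "\<dots> = (u ^ Suc N)\<^sup>2" unfolding mult.commute[of 2] by (rule power_mult)
    finally show ?thesis unfolding u(1) by simp
  qed
  have Re_u2: "Re (u\<^sup>2) = 2 * c\<^sup>2 - 1" using circle by (simp add: c_def power2_eq_square)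
  have c: "4 * c\<^sup>2 + 2 * c - 1 = 0"
  proof -
    have "(u - 1) * (1 + u + u\<^sup>2 + u ^ Suc p + u ^ N) = u ^ Suc N - 1"
      unfolding assms(1) by (simp add: eval_nat_numeral algebra_simps)
    moreover have "u \<noteq> 1" using u(2) by auto
    ultimately have "1 + u + u\<^sup>2 + (cnj u)\<^sup>2 + cnj u = 0"
      unfolding unity_power_N(1,2)[OF u(1)] u(1) by simp
    then have "Re (1 + u + u\<^sup>2 + (cnj u)\<^sup>2 + cnj u) = 0" by (simp only: zero_complex.simps)
    moreover have "Re ((cnj u)\<^sup>2) = Re (u\<^sup>2)" by (simp add: power2_eq_square)
    ultimately show ?thesis using Re_u2 by (simp add: c_def)
  qed
  have g1: "\<bar>B / 4 * Im u\<bar> \<le> g c"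
    using first_order_condition_real[OF assms(2) u(1)] unfolding N c_def g_def by simp
  have g2: "0 \<le> g (2 * c\<^sup>2 - 1)"
    using first_order_condition_real[OF assms(2) u2] unfolding N Re_u2 g_def by linarith
  \<comment> \<open>The total amount by which the critical points are further left than necessary.\<close>
  define d where "d = (\<Sum>k<N. - 7 / 10 + (\<eta> k)\<^sup>2 / 2 - \<xi> k)"
  have gap: "0 \<le> - 7 / 10 + (\<eta> k)\<^sup>2 / 2 - \<xi> k" if "k < N" for k using \<xi>_le[OF that] by simp
  then have d: "0 \<le> d" unfolding d_def by (intro sum_nonneg) auto
  have a: "a = - 14 / 5 + S / 2 - d" unfolding d_def using a_eq unfolding N by simp
  have c2: "c\<^sup>2 = 1 / 4 - c / 2" using c by simp
  then have c_sq: "c * c = 1 / 4 - c / 2" by (simp add: power2_eq_square)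
  define c' where "c' = - 1 / 2 - c"
  have c': "2 * c\<^sup>2 - 1 = c'" unfolding c2 c'_def by simp
  have c'2: "c'\<^sup>2 = 1 / 4 - c' / 2" unfolding c'_def power2_eq_square using c_sq by (simp add: field_simps)
  have "c \<le> 1" unfolding c_def using complex_Re_le_cmod[of u] unity_power_N(3)[OF u(1)] by simp
  have "c' \<le> 1" using complex_Re_le_cmod[of "u\<^sup>2"] unity_power_N(3)[OF u2] unfolding Re_u2 c' by simp
  have gc: "g c = 1 + a / 4 * (1 - c) - S / 3 * (3 / 4 + c / 2)" unfolding g_def c2 by simp
  have gc': "g c' = 1 + a / 4 * (1 - c') - S / 3 * (3 / 4 + c' / 2)" unfolding g_def c'2 by simp
  have "(3 - 2 * c) * g c + (3 - 2 * c') * g c' = - (5 / 2) * d"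
  proof -
    have "(3 - 2 * x) * (1 + s / 4 * (1 - x) - S / 3 * (3 / 4 + x / 2))
       + (3 - 2 * (- 1 / 2 - x)) * (1 + s / 4 * (1 - (- 1 / 2 - x)) - S / 3 * (3 / 4 + (- 1 / 2 - x) / 2))
       = 7 + 5 / 2 * s - 5 / 4 * S" if "x * x = 1 / 4 - x / 2" for x s
    proof -
      have "(3 - 2 * x) * (1 + s / 4 * (1 - x) - S / 3 * (3 / 4 + x / 2))
       + (3 - 2 * (- 1 / 2 - x)) * (1 + s / 4 * (1 - (- 1 / 2 - x)) - S / 3 * (3 / 4 + (- 1 / 2 - x) / 2))
       = 7 + 5 / 2 * s - 5 / 4 * S + (s + 2 * S / 3) * (x * x - (1 / 4 - x / 2))"
        by (simp add: field_simps)
      then show ?thesis unfolding that by simp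
    qed
    from this[OF c_sq, of a] have "(3 - 2 * c) * g c + (3 - 2 * c') * g c' = 7 + 5 / 2 * a - 5 / 4 * S"
      unfolding gc gc' unfolding c'_def .
    then show ?thesis using a by linarith
  qed
  moreover have "0 \<le> (3 - 2 * c) * g c" using \<open>c \<le> 1\<close> g1 by simp
  moreover have "0 \<le> (3 - 2 * c') * g c'" using \<open>c' \<le> 1\<close> g2 unfolding c' by simp
  ultimately have z: "d = 0" "(3 - 2 * c) * g c = 0" "(3 - 2 * c') * g c' = 0" using d by linarith+
  then have g0: "g c = 0" "g c' = 0" using \<open>c \<le> 1\<close> \<open>c' \<le> 1\<close> by auto
  then show "B = 0" using g1 u(2) by simp
  have "g c + g c' = 1 / 4 - 5 / 48 * S"
    unfolding gc gc' a z(1) unfolding c'_def by (simp add: field_simps)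
  then show "S = 12 / 5" using g0 by simp
  show "\<xi> k = - 7 / 10 + (\<eta> k)\<^sup>2 / 2" if "k < 4" for k
  proof -
    have "- 7 / 10 + (\<eta> k)\<^sup>2 / 2 - \<xi> k = 0"
      using z(1) gap that sum_nonneg_eq_0_iff[of "{..<N}" "\<lambda>k. - 7 / 10 + (\<eta> k)\<^sup>2 / 2 - \<xi> k"]
      unfolding d_def N(1) by auto
    then show ?thesis by simp
  qed
qed

end

section \<open>Second order analysis in degree five\<close>

lemma coeff_root_prod_4:
  "coeff (root_prod 4 a) 4 = 1"
  "coeff (root_prod 4 a) 3 = - (a 0 + a 1 + a 2 + a 3)"
  "coeff (root_prod 4 a) 2 = a 0 * a 1 + a 0 * a 2 + a 0 * a 3 + a 1 * a 2 + a 1 * a 3 + a 2 * a 3"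
  "coeff (root_prod 4 a) 1 = - (a 1 * a 2 * a 3 + a 0 * a 2 * a 3 + a 0 * a 1 * a 3 + a 0 * a 1 * a 2)"
  "coeff (root_prod 4 a) 0 = a 0 * a 1 * a 2 * a 3"
  by (simp_all add: root_prod_def eval_nat_numeral algebra_simps)

lemma sum_lessThan_4: "(\<Sum>k<4. f k) = f 0 + f 1 + f 2 + f (3 :: nat)" for f :: "nat \<Rightarrow> 'a :: comm_monoid_add"
  by (simp add: eval_nat_numeral)

lemma prod_lessThan_4: "(\<Prod>k<4. f k) = f 0 * f 1 * f 2 * f (3 :: nat)" for f :: "nat \<Rightarrow> 'a :: comm_monoid_mult"
  by (simp add: eval_nat_numeral)

text \<open>
  In polar form the left side is \<open>3 ln \<rho> + (1 / \<rho> - \<rho>) cos \<theta>\<close>, which is about \<open>- (1 - \<rho>) (3 - 2 cos \<theta>)\<close>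
  for \<open>\<rho>\<close> near 1. The weights \<open>3 - 2 cos \<theta>\<close> are those that make the first order conditions cancel,
  and summed over the roots the left side is a function of the coefficients of the polynomial.
  Hence this is the right inequality to expand to second order.
\<close>

lemma inverse_minus_le_ln:
  fixes w :: complex
  assumes "1 / 2 \<le> cmod w" "cmod w \<le> 1"
  shows "3 * ln (cmod w) + Re (1 / w - w) \<le> 0"
proof -
  define \<rho> where "\<rho> = cmod w"
  have \<rho>: "1 / 2 \<le> \<rho>" "\<rho> \<le> 1" using assms by (simp_all add: \<rho>_def)
  have "Re (1 / w - w) = Re w * (1 / \<rho>\<^sup>2 - 1)"
    unfolding \<rho>_def by (simp add: Re_divide cmod_power2 algebra_simps)
  also have "\<dots> \<le> \<rho> * (1 / \<rho>\<^sup>2 - 1)"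
  proof (rule mult_right_mono)
    show "Re w \<le> \<rho>" unfolding \<rho>_def by (rule complex_Re_le_cmod)
    have "\<rho>\<^sup>2 \<le> 1" using \<rho> by (simp add: power_le_one)
    then show "0 \<le> 1 / \<rho>\<^sup>2 - 1" using \<rho> by (simp add: le_divide_eq)
  qed
  also have "\<dots> = (1 - \<rho>) * (1 + \<rho>) / \<rho>" using \<rho> by (simp add: field_simps power2_eq_square)
  also have "\<dots> \<le> 3 * (1 - \<rho>)"
  proof (rule mult_imp_div_pos_le)
    have "(1 - \<rho>) * (1 + \<rho>) \<le> (1 - \<rho>) * (3 * \<rho>)" using \<rho> by (intro mult_left_mono) auto
    then show "(1 - \<rho>) * (1 + \<rho>) \<le> 3 * (1 - \<rho>) * \<rho>" by (simp add: algebra_simps)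
  qed (use \<rho> in simp)
  also have "\<dots> \<le> 3 * (- ln \<rho>)" using ln_le_minus_one[of \<rho>] \<rho> by simp
  finally show ?thesis by (simp add: \<rho>_def)
qed

text \<open>
  Vieta for the roots other than \<open>\<beta>\<close>, in terms of the coefficients \<open>F\<close> of the derivative. The
  number \<open>M\<close> is \<open>- P(0) / \<beta>\<close>.
\<close>

lemma quintic_root_sums:
  assumes far: "far_critical 4 \<beta> z \<zeta>" and "0 < \<beta>"
  defines "F \<equiv> coeff (root_prod 4 \<zeta>)" and "b \<equiv> complex_of_real \<beta>"
  defines "M \<equiv> b ^ 4 + 5 / 4 * F 3 * b ^ 3 + 5 / 3 * F 2 * b ^ 2 + 5 / 2 * F 1 * b + 5 * F 0"
  shows "(\<Prod>i<4. z i) = M"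
    and "(\<Sum>i<4. z i) = - b - 5 / 4 * F 3"
    and "M \<noteq> 0 \<Longrightarrow> (\<Sum>i<4. 1 / z i) = 5 * F 0 / (b * M) - 1 / b"
proof -
  have b: "b \<noteq> 0" using assms(2) by (simp add: b_def)
  have pd: "pderiv ([:- b, 1:] * root_prod 4 z) = smult 5 (root_prod 4 \<zeta>)"
    using far unfolding far_critical_def b_def by simp
  have "(0 - b) * (\<Prod>i<4. 0 - z i) = 0 ^ Suc 4 - 1 + perturbation 4 \<beta> \<zeta> 0"
    unfolding b_def by (rule far_critical_poly[OF far])
  also have "\<dots> = - (b * M)"
    unfolding perturbation_def M_def F_def[symmetric] b_def[symmetric] sum_lessThan_4
    by (simp add: eval_nat_numeral algebra_simps)
  finally have "b * (\<Prod>i<4. z i) = b * M" by (simp add: prod_lessThan_4)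
  then show P: "(\<Prod>i<4. z i) = M" using b by simp
  have shift: "coeff ([:- b, 1:] * root_prod 4 z) (Suc i) = coeff (root_prod 4 z) i - b * coeff (root_prod 4 z) (Suc i)" for i
    by simp
  have "coeff (pderiv ([:- b, 1:] * root_prod 4 z)) 3 = 5 * F 3" unfolding pd F_def by simp
  moreover have "Suc 3 = 4" by simp
  ultimately have F3: "5 * F 3 = 4 * (- (z 0 + z 1 + z 2 + z 3) - b)"
    unfolding coeff_pderiv shift by (simp only: coeff_root_prod_4) simp
  have "(\<Sum>i<4. z i) = - b - (5 * F 3) / 4" unfolding F3 sum_lessThan_4 by (simp add: field_simps)
  then show "(\<Sum>i<4. z i) = - b - 5 / 4 * F 3" by simp
  have "coeff (pderiv ([:- b, 1:] * root_prod 4 z)) 0 = 5 * F 0" unfolding pd F_def by simp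
  then have F0: "z 0 * z 1 * z 2 * z 3 + b * (z 1 * z 2 * z 3 + z 0 * z 2 * z 3 + z 0 * z 1 * z 3 + z 0 * z 1 * z 2) = 5 * F 0"
    unfolding coeff_pderiv shift by (simp add: coeff_root_prod_4[unfolded One_nat_def] algebra_simps)
  show "(\<Sum>i<4. 1 / z i) = 5 * F 0 / (b * M) - 1 / b" if "M \<noteq> 0"
  proof -
    have "z 0 \<noteq> 0" "z 1 \<noteq> 0" "z 2 \<noteq> 0" "z 3 \<noteq> 0" using that P unfolding prod_lessThan_4 by auto
    then show ?thesis using b unfolding P[symmetric] F0[symmetric] sum_lessThan_4 prod_lessThan_4
      by (simp add: field_simps)
  qed
qed

text \<open>
  Summation of the previous inequality over the roots, with \<open>ln\<close> replaced by the lower bound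
  \<open>1 - 1 / x\<close>. It agrees with \<open>x - 1\<close> up to a square, and at the place of use \<open>Re M - 1\<close> is
  negligible compared with \<open>1 - \<beta>\<close>.
\<close>

lemma quintic_log_inequality:
  assumes far: "far_critical 4 \<beta> z \<zeta>" and "0 < \<beta>"
  defines "F \<equiv> coeff (root_prod 4 \<zeta>)" and "b \<equiv> complex_of_real \<beta>"
  defines "M \<equiv> b ^ 4 + 5 / 4 * F 3 * b ^ 3 + 5 / 3 * F 2 * b ^ 2 + 5 / 2 * F 1 * b + 5 * F 0"
  assumes "1 / 2 \<le> Re M"
  shows "3 * ((Re M - 1) - (Re M - 1)\<^sup>2 / Re M) + 5 * Re (F 0 / (b * M)) - 1 / \<beta> + \<beta> + 5 / 4 * Re (F 3) \<le> 0"
proof -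
  note sums = quintic_root_sums[OF far assms(2), folded F_def b_def, folded M_def]
  have z1: "cmod (z i) \<le> 1" if "i < 4" for i using far that by (simp add: far_critical_def)
  have Pi: "Re M \<le> cmod M" by (rule complex_Re_le_cmod)
  then have P0: "M \<noteq> 0" using assms(6) by auto
  have zhalf: "1 / 2 \<le> cmod (z i)" if i: "i < 4" for i
  proof -
    have "1 / 2 \<le> cmod (\<Prod>i<4. z i)" using assms(6) Pi sums(1) by simp
    also have "\<dots> = cmod (z i) * (\<Prod>j\<in>{..<4} - {i}. cmod (z j))"
      unfolding prod_norm[symmetric] by (rule prod.remove) (use i in auto)
    also have "\<dots> \<le> cmod (z i) * 1"
      by (intro mult_left_mono prod_le_1) (use z1 in auto)
    finally show ?thesis by simp
  qed
  have "ln (cmod M) = (\<Sum>i<4. ln (cmod (z i)))"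
  proof -
    have "cmod (z i) > 0" if "i < 4" for i using zhalf[OF that] by linarith
    then show ?thesis unfolding sums(1)[symmetric] prod_norm[symmetric] by (subst ln_prod) auto
  qed
  then have "3 * ln (cmod M) + Re ((\<Sum>i<4. 1 / z i) - (\<Sum>i<4. z i))
      = (\<Sum>i<4. 3 * ln (cmod (z i)) + Re (1 / z i - z i))"
    by (simp add: sum_lessThan_4 algebra_simps)
  also have "\<dots> \<le> 0"
    by (intro sum_nonpos inverse_minus_le_ln zhalf z1) auto
  finally have *: "3 * ln (cmod M) + Re ((\<Sum>i<4. 1 / z i) - (\<Sum>i<4. z i)) \<le> 0" .
  have "Re ((\<Sum>i<4. 1 / z i) - (\<Sum>i<4. z i)) = 5 * Re (F 0 / (b * M)) - 1 / \<beta> + \<beta> + 5 / 4 * Re (F 3)"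
  proof -
    have "1 / b = of_real (1 / \<beta>)" by (simp add: b_def)
    then have "(\<Sum>i<4. 1 / z i) - (\<Sum>i<4. z i) = of_real 5 * (F 0 / (b * M)) - of_real (1 / \<beta>) + of_real \<beta> + of_real (5 / 4) * F 3"
      unfolding sums(2) sums(3)[OF P0] by (simp add: b_def)
    moreover have "Re (of_real r * v) = r * Re v" for r v by simp
    ultimately show ?thesis by (simp only: plus_complex.simps minus_complex.simps Re_complex_of_real)
  qed
  with * have "3 * ln (cmod M) + (5 * Re (F 0 / (b * M)) - 1 / \<beta> + \<beta> + 5 / 4 * Re (F 3)) \<le> 0" by (simp only:)
  moreover have "(Re M - 1) - (Re M - 1)\<^sup>2 / Re M \<le> ln (cmod M)"
  proof -
    have "(Re M - 1) - (Re M - 1)\<^sup>2 / Re M = 1 - 1 / Re M"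
      using assms(6) by (simp add: field_simps power2_eq_square)
    also have "\<dots> \<le> ln (Re M)" using ln_le_minus_one[of "1 / Re M"] assms(6) by (simp add: ln_div)
    also have "\<dots> \<le> ln (cmod M)" by (subst ln_le_cancel_iff) (use Pi assms(6) in auto)
    finally show ?thesis .
  qed
  ultimately show ?thesis by argo
qed

text \<open>
  The second order term in the limit is \<open>59/10 + 10 E\<close>, and \<open>E\<close> is at least \<open>- 9/25\<close> by the
  inequality of arithmetic and geometric means. For the value of the term, the sum \<open>t\<close> of fourth powers is
  expressed through \<open>E\<close> by Newton's identities.
\<close>

lemma quintic_second_order_positive:
  fixes \<eta> \<xi> :: "nat \<Rightarrow> real"
  assumes "\<eta> 0 + \<eta> 1 + \<eta> 2 + \<eta> 3 = 0"
    and "(\<eta> 0)\<^sup>2 + (\<eta> 1)\<^sup>2 + (\<eta> 2)\<^sup>2 + (\<eta> 3)\<^sup>2 = 12 / 5"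
    and \<xi>: "\<And>k. k < 4 \<Longrightarrow> \<xi> k = - 7 / 10 + (\<eta> k)\<^sup>2 / 2"
  defines "E \<equiv> \<eta> 0 * \<eta> 1 * \<eta> 2 * \<eta> 3"
  defines "X \<equiv> (\<xi> 0)\<^sup>2 + (\<xi> 1)\<^sup>2 + (\<xi> 2)\<^sup>2 + (\<xi> 3)\<^sup>2"
  defines "f \<equiv> \<xi> 0 * (\<eta> 1 * \<eta> 2 + \<eta> 1 * \<eta> 3 + \<eta> 2 * \<eta> 3) + \<xi> 1 * (\<eta> 0 * \<eta> 2 + \<eta> 0 * \<eta> 3 + \<eta> 2 * \<eta> 3)
    + \<xi> 2 * (\<eta> 0 * \<eta> 1 + \<eta> 0 * \<eta> 3 + \<eta> 1 * \<eta> 3) + \<xi> 3 * (\<eta> 0 * \<eta> 1 + \<eta> 0 * \<eta> 2 + \<eta> 1 * \<eta> 2)"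
  shows "0 < - 18 / 5 - 9 / 2 - 5 * X + 32 / 5 + 15 / 2 * f + 20 * E"
proof -
  define p q r s where "p = \<eta> 0" and "q = \<eta> 1" and "r = \<eta> 2" and "s = \<eta> 3"
  note pqrs = p_def[symmetric] q_def[symmetric] r_def[symmetric] s_def[symmetric]
  define t where "t = p ^ 4 + q ^ 4 + r ^ 4 + s ^ 4"
  have sum: "p + q + r + s = 0" and sq: "p\<^sup>2 + q\<^sup>2 + r\<^sup>2 + s\<^sup>2 = 12 / 5"
    using assms(1,2) unfolding pqrs .
  have xi: "\<xi> 0 = - 7 / 10 + p\<^sup>2 / 2" "\<xi> 1 = - 7 / 10 + q\<^sup>2 / 2" "\<xi> 2 = - 7 / 10 + r\<^sup>2 / 2" "\<xi> 3 = - 7 / 10 + s\<^sup>2 / 2"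
    using \<xi>[of 0] \<xi>[of 1] \<xi>[of 2] \<xi>[of 3] unfolding pqrs by simp_all
  have s: "s = - (p + q + r)" using sum by simp
  have "2 * t = (p\<^sup>2 + q\<^sup>2 + r\<^sup>2 + s\<^sup>2)\<^sup>2 - 8 * (p * q * r * s)"
    unfolding t_def s by (simp add: power2_eq_square power4_eq_xxxx algebra_simps)
  then have t: "t = 72 / 25 - 4 * E" unfolding sq E_def pqrs by (simp add: power2_eq_square)
  have X: "X = 49 / 25 - 7 / 10 * (p\<^sup>2 + q\<^sup>2 + r\<^sup>2 + s\<^sup>2) + t / 4"
    unfolding X_def xi t_def by (simp add: power2_eq_square power4_eq_xxxx field_simps)
  have e2: "q * r + q * s + r * s = p\<^sup>2 - (p\<^sup>2 + q\<^sup>2 + r\<^sup>2 + s\<^sup>2) / 2"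
    "p * r + p * s + r * s = q\<^sup>2 - (p\<^sup>2 + q\<^sup>2 + r\<^sup>2 + s\<^sup>2) / 2"
    "p * q + p * s + q * s = r\<^sup>2 - (p\<^sup>2 + q\<^sup>2 + r\<^sup>2 + s\<^sup>2) / 2"
    "p * q + p * r + q * r = s\<^sup>2 - (p\<^sup>2 + q\<^sup>2 + r\<^sup>2 + s\<^sup>2) / 2"
    unfolding s by (simp_all add: power2_eq_square field_simps)
  have "f = (- 7 / 10 + p\<^sup>2 / 2) * (p\<^sup>2 - 6 / 5) + (- 7 / 10 + q\<^sup>2 / 2) * (q\<^sup>2 - 6 / 5)
      + (- 7 / 10 + r\<^sup>2 / 2) * (r\<^sup>2 - 6 / 5) + (- 7 / 10 + s\<^sup>2 / 2) * (s\<^sup>2 - 6 / 5)"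
    unfolding f_def xi pqrs e2 sq by simp
  also have "\<dots> = t / 2 - 13 / 10 * (p\<^sup>2 + q\<^sup>2 + r\<^sup>2 + s\<^sup>2) + 84 / 25"
    unfolding t_def by (simp add: power2_eq_square power4_eq_xxxx field_simps)
  finally have f: "f = t / 2 + 6 / 25" unfolding sq by simp
  have "- 9 / 25 \<le> E"
  proof -
    have "\<bar>p * q\<bar> \<le> (p\<^sup>2 + q\<^sup>2) / 2" "\<bar>r * s\<bar> \<le> (r\<^sup>2 + s\<^sup>2) / 2"
      using sum_squares_bound[of "\<bar>p\<bar>" "\<bar>q\<bar>"] sum_squares_bound[of "\<bar>r\<bar>" "\<bar>s\<bar>"] by (simp_all add: abs_mult)
    then have "\<bar>p * q\<bar> * \<bar>r * s\<bar> \<le> (p\<^sup>2 + q\<^sup>2) / 2 * ((r\<^sup>2 + s\<^sup>2) / 2)"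
      by (rule mult_mono) auto
    also have "\<dots> \<le> ((p\<^sup>2 + q\<^sup>2 + r\<^sup>2 + s\<^sup>2) / 4)\<^sup>2"
    proof -
      have "x / 2 * (y / 2) \<le> ((x + y) / 4)\<^sup>2" for x y :: real
        using zero_le_power2[of "x - y"] by (simp add: power2_eq_square field_simps)
      from this[of "p\<^sup>2 + q\<^sup>2" "r\<^sup>2 + s\<^sup>2"] show ?thesis by (simp only: add.assoc)
    qed
    also have "\<dots> = 9 / 25" unfolding sq by (simp add: power2_eq_square)
    finally have "\<bar>E\<bar> \<le> 9 / 25" unfolding E_def pqrs by (simp add: abs_mult mult.assoc)
    then show ?thesis by linarith
  qed
  then show ?thesis unfolding X f sq t by (simp add: field_simps)
qed

text \<open>
  The logarithmic inequality divided by \<open>e^2\<close>, where \<open>e = 1 - \<beta>\<close> and all variables are already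
  rescaled to be bounded. The only quantity that is not known to second order is \<open>a\<close>. It has a positive coefficient and is replaced by
  the lower bound \<open>A\<close> from the distance condition; after that all terms of order \<open>e\<close> cancel, also
  those with \<open>S\<close>, so the first order limits determine the outcome.
\<close>

lemma quintic_expansion:
  fixes e a S X W f1 f0 T M' \<beta> M :: real
  assumes e: "0 < e" "e < 1" and \<beta>: "\<beta> = 1 - e"
    and a: "4 * ((1 - 3 / 10 * \<beta> * e)\<^sup>2 - \<beta>\<^sup>2) - e\<^sup>2 * X - e * S \<le> 2 * \<beta> * (e * a)"
    and M: "M = \<beta> ^ 4 + 5 / 4 * (e * a) * \<beta> ^ 3 + 5 / 3 * ((e\<^sup>2 * a\<^sup>2 - e\<^sup>2 * W\<^sup>2 - e\<^sup>2 * X + e * S) / 2) * \<beta>\<^sup>2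
      + 5 / 2 * (e\<^sup>2 * f1) * \<beta> + 5 * (e\<^sup>2 * f0)"
    and M': "M - 1 = e * M'"
    and log: "3 * ((M - 1) - (M - 1)\<^sup>2 / M) + 5 * (e\<^sup>2 * T) - 1 / \<beta> + \<beta> + 5 / 4 * (e * a) \<le> 0"
  shows "(- 18 / 5 + 267 / 40 * e + 99 / 40 * e ^ 2 - 27 / 4 * e ^ 3 + 27 / 8 * e ^ 4 - 27 / 40 * e ^ 5) / \<beta>
    - 5 / 8 * S * (1 + \<beta> + \<beta>\<^sup>2) / \<beta> - X * (5 / 8 * (3 * \<beta> ^ 3 + 1) / \<beta> + 5 / 2 * \<beta>\<^sup>2)
    + 5 / 2 * \<beta>\<^sup>2 * (a\<^sup>2 - W\<^sup>2) + 15 / 2 * \<beta> * f1 + 15 * f0 + 5 * T - 3 * M'\<^sup>2 / M \<le> 0"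
    (is "?P / \<beta> - ?s - ?x + ?q + ?r1 + ?r0 + ?t - ?l \<le> 0")
proof -
  have b: "0 < \<beta>" using e \<beta> by simp
  define D where "D = (1 - 3 / 10 * \<beta> * e)\<^sup>2 - \<beta>\<^sup>2"
  have P: "e\<^sup>2 * ?P = 3 * \<beta> ^ 5 - 3 * \<beta> + \<beta>\<^sup>2 - 1 + 5 / 2 * (3 * \<beta> ^ 3 + 1) * D"
    unfolding D_def \<beta> by (simp add: eval_nat_numeral field_simps)
  define A where "A = (4 * D - e\<^sup>2 * X - e * S) / (2 * \<beta>)"
  have "A \<le> e * a" using a b unfolding A_def D_def by (simp add: divide_le_eq mult.commute mult.left_commute)
  then have slack: "0 \<le> (15 / 4 * \<beta> ^ 3 + 5 / 4) * (e * a - A)" using b by simp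
  have cube: "\<beta> ^ 3 - 1 = - e * (1 + \<beta> + \<beta>\<^sup>2)" unfolding \<beta> by (simp add: eval_nat_numeral algebra_simps)
  have main: "3 * (M - 1) + 5 / 4 * (e * a) + \<beta> - 1 / \<beta> - (15 / 4 * \<beta> ^ 3 + 5 / 4) * (e * a - A)
     = (3 * \<beta> ^ 5 - 3 * \<beta> + \<beta>\<^sup>2 - 1 + 5 / 2 * (3 * \<beta> ^ 3 + 1) * D) / \<beta>
      + 5 / 8 * (e * S) * (\<beta> ^ 3 - 1) / \<beta> - (e\<^sup>2 * X) * (5 / 8 * (3 * \<beta> ^ 3 + 1) / \<beta> + 5 / 2 * \<beta>\<^sup>2)
      + 5 / 2 * \<beta>\<^sup>2 * (e\<^sup>2 * a\<^sup>2 - e\<^sup>2 * W\<^sup>2) + 15 / 2 * \<beta> * (e\<^sup>2 * f1) + 15 * (e\<^sup>2 * f0)"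
    unfolding M A_def using b by (simp add: field_simps) (simp add: eval_nat_numeral algebra_simps)
  have "e\<^sup>2 * (?P / \<beta> - ?s - ?x + ?q + ?r1 + ?r0 + ?t - ?l)
     = (e\<^sup>2 * ?P) / \<beta> + 5 / 8 * (e * S) * (- e * (1 + \<beta> + \<beta>\<^sup>2)) / \<beta> - (e\<^sup>2 * X) * (5 / 8 * (3 * \<beta> ^ 3 + 1) / \<beta> + 5 / 2 * \<beta>\<^sup>2)
      + 5 / 2 * \<beta>\<^sup>2 * (e\<^sup>2 * a\<^sup>2 - e\<^sup>2 * W\<^sup>2) + 15 / 2 * \<beta> * (e\<^sup>2 * f1) + 15 * (e\<^sup>2 * f0)
      + 5 * (e\<^sup>2 * T) - 3 * ((e * M')\<^sup>2 / M)"
    by (simp add: power2_eq_square algebra_simps add_divide_distrib diff_divide_distrib)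
  also have "\<dots> = 3 * (M - 1) + 5 / 4 * (e * a) + \<beta> - 1 / \<beta> - (15 / 4 * \<beta> ^ 3 + 5 / 4) * (e * a - A)
      + 5 * (e\<^sup>2 * T) - 3 * ((M - 1)\<^sup>2 / M)"
    unfolding P cube[symmetric] M'[symmetric] main ..
  also have "\<dots> \<le> 0" using log slack by argo
  finally show ?thesis using e(1) by (simp add: mult_le_0_iff)
qed

context far_critical_limit
begin

lemma Re_triple_lim:
  assumes "i < N" "j < N" "k < N"
  shows "(\<lambda>m. Re (\<zeta> m i * \<zeta> m j * \<zeta> m k) / (h m) ^ 4)
    \<longlonglongrightarrow> - (\<xi> i * (\<eta> j * \<eta> k) + \<xi> j * (\<eta> i * \<eta> k) + \<xi> k * (\<eta> i * \<eta> j))"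
proof -
  define x y where "x l m = Re (\<zeta> m l) / (h m)\<^sup>2" and "y l m = Im (\<zeta> m l) / h m" for l m
  have lim: "x l \<longlonglongrightarrow> \<xi> l" "y l \<longlonglongrightarrow> \<eta> l" if "l < N" for l
    using Re_lim[OF that] Im_lim[OF that] by (simp_all add: x_def[abs_def] y_def[abs_def])
  have "Re (\<zeta> m i * \<zeta> m j * \<zeta> m k) / (h m) ^ 4 = (h m)\<^sup>2 * (x i m * x j m * x k m)
      - (x i m * (y j m * y k m) + x j m * (y i m * y k m) + x k m * (y i m * y j m))" for m
  proof -
    have eq: "Re (\<zeta> m l) = (h m)\<^sup>2 * x l m" "Im (\<zeta> m l) = h m * y l m" for l
      using h_pos[of m] by (simp_all add: x_def y_def)
    show ?thesis using h_pos[of m] by (simp add: eq field_simps) (simp add: eval_nat_numeral algebra_simps)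
  qed
  moreover have "(\<lambda>m. (h m)\<^sup>2 * (x i m * x j m * x k m)
      - (x i m * (y j m * y k m) + x j m * (y i m * y k m) + x k m * (y i m * y j m)))
    \<longlonglongrightarrow> 0\<^sup>2 * (\<xi> i * \<xi> j * \<xi> k) - (\<xi> i * (\<eta> j * \<eta> k) + \<xi> j * (\<eta> i * \<eta> k) + \<xi> k * (\<eta> i * \<eta> j))"
    by (intro tendsto_intros h_lim lim assms)
  ultimately show ?thesis by simp
qed

lemma \<zeta>_lim: "k < N \<Longrightarrow> (\<lambda>m. \<zeta> m k) \<longlonglongrightarrow> 0"
proof -
  assume k: "k < N"
  have "(\<lambda>m. of_real (h m) * (\<zeta> m k / of_real (h m))) \<longlonglongrightarrow> of_real 0 * (\<i> * of_real (\<eta> k))"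
    by (intro tendsto_intros h_lim scaled_lim k)
  moreover have "of_real (h m) * (\<zeta> m k / of_real (h m)) = \<zeta> m k" for m using h_pos[of m] by simp
  ultimately show ?thesis by simp
qed

text \<open>
  Passing to the limit in the second order expansion contradicts the positivity of its limit.
\<close>

lemma not_quintic:
  assumes p: "p = 2" and bB: "b \<longlonglongrightarrow> B"
  shows False
proof -
  have N: "N = 4" using p by simp
  note rigid = quintic_rigid[OF p bB]
  define E where "E = \<eta> 0 * \<eta> 1 * \<eta> 2 * \<eta> 3"
  define X where "X = (\<xi> 0)\<^sup>2 + (\<xi> 1)\<^sup>2 + (\<xi> 2)\<^sup>2 + (\<xi> 3)\<^sup>2"
  define f where "f = \<xi> 0 * (\<eta> 1 * \<eta> 2 + \<eta> 1 * \<eta> 3 + \<eta> 2 * \<eta> 3) + \<xi> 1 * (\<eta> 0 * \<eta> 2 + \<eta> 0 * \<eta> 3 + \<eta> 2 * \<eta> 3)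
    + \<xi> 2 * (\<eta> 0 * \<eta> 1 + \<eta> 0 * \<eta> 3 + \<eta> 1 * \<eta> 3) + \<xi> 3 * (\<eta> 0 * \<eta> 1 + \<eta> 0 * \<eta> 2 + \<eta> 1 * \<eta> 2)"
  have sum0: "\<eta> 0 + \<eta> 1 + \<eta> 2 + \<eta> 3 = 0"
    using sum_\<eta>_zero unfolding N sum_lessThan_4 .
  have S: "(\<eta> 0)\<^sup>2 + (\<eta> 1)\<^sup>2 + (\<eta> 2)\<^sup>2 + (\<eta> 3)\<^sup>2 = 12 / 5"
    using rigid(1) unfolding S_def N sum_lessThan_4 .
  have positive: "0 < - 18 / 5 - 9 / 2 - 5 * X + 32 / 5 + 15 / 2 * f + 20 * E"
    using quintic_second_order_positive[OF sum0 S rigid(3)] unfolding E_def X_def f_def .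
  define F where "F m = coeff (root_prod 4 (\<zeta> m))" for m
  define e where "e m = (h m)\<^sup>2" for m
  have e: "0 < e m" "\<beta> m = 1 - e m" for m using h_pos[of m] \<beta>(2)[of m] by (simp_all add: e_def h_sq)
  have e1: "e m \<le> 1" for m using \<beta>(1)[of m] e(2)[of m] by simp
  have e_lim: "e \<longlonglongrightarrow> 0" unfolding e_def using tendsto_power[OF h_lim, of 2] by simp
  have h4: "(h m) ^ 4 = (e m)\<^sup>2" for m by (simp add: e_def flip: power_mult)
  \<comment> \<open>From here to \<open>M'\<close> the arguments of \<open>quintic_expansion\<close> are defined; all of them converge.\<close>
  define x where "x m k = Re (\<zeta> m k) / e m" for m k
  define y where "y m k = Im (\<zeta> m k) / h m" for m k
  have x_lim: "(\<lambda>m. x m k) \<longlonglongrightarrow> \<xi> k" and y_lim: "(\<lambda>m. y m k) \<longlonglongrightarrow> \<eta> k" if "k < 4" for k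
    using Re_lim[of k] Im_lim[of k] that unfolding N by (simp_all add: x_def y_def e_def)
  have x_eq: "Re (\<zeta> m k) = e m * x m k" and y_eq: "Im (\<zeta> m k) = h m * y m k" for m k
    using h_pos[of m] e(1)[of m] by (simp_all add: x_def y_def)
  define a' where "a' m = - (\<Sum>k<4. x m k)" for m
  define S' where "S' m = (\<Sum>k<4. (y m k)\<^sup>2)" for m
  define X' where "X' m = (\<Sum>k<4. (x m k)\<^sup>2)" for m
  define f1 where "f1 m = Re (F m 1) / (e m)\<^sup>2" for m
  define f0 where "f0 m = Re (F m 0) / (e m)\<^sup>2" for m
  define M where "M m = of_real (\<beta> m) ^ 4 + 5 / 4 * F m 3 * of_real (\<beta> m) ^ 3 + 5 / 3 * F m 2 * of_real (\<beta> m) ^ 2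
      + 5 / 2 * F m 1 * of_real (\<beta> m) + 5 * F m 0" for m
  define T where "T m = Re (F m 0 / (of_real (\<beta> m) * M m)) / (e m)\<^sup>2" for m
  define M' where "M' m = (Re (M m) - 1) / e m" for m
  have a'_lim: "a' \<longlonglongrightarrow> 8 / 5"
  proof -
    have "a' \<longlonglongrightarrow> - (\<Sum>k<4. \<xi> k)" unfolding a'_def by (intro tendsto_intros x_lim) simp
    moreover have "(\<Sum>k<4. \<xi> k) = - 8 / 5"
      unfolding sum_lessThan_4 using rigid(3)[of 0] rigid(3)[of 1] rigid(3)[of 2] rigid(3)[of 3] S by simp
    ultimately show ?thesis by simp
  qed
  have S'_lim: "S' \<longlonglongrightarrow> 12 / 5"
  proof -
    have "S' \<longlonglongrightarrow> (\<Sum>k<4. (\<eta> k)\<^sup>2)" unfolding S'_def by (intro tendsto_intros y_lim) simp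
    then show ?thesis unfolding sum_lessThan_4 S .
  qed
  have X'_lim: "X' \<longlonglongrightarrow> X"
  proof -
    have "X' \<longlonglongrightarrow> (\<Sum>k<4. (\<xi> k)\<^sup>2)" unfolding X'_def by (intro tendsto_intros x_lim) simp
    then show ?thesis unfolding sum_lessThan_4 X_def .
  qed
  have f1_lim: "f1 \<longlonglongrightarrow> f"
  proof -
    have t: "(\<lambda>m. Re (\<zeta> m i * \<zeta> m j * \<zeta> m k) / (e m)\<^sup>2)
      \<longlonglongrightarrow> - (\<xi> i * (\<eta> j * \<eta> k) + \<xi> j * (\<eta> i * \<eta> k) + \<xi> k * (\<eta> i * \<eta> j))" if "i < 4" "j < 4" "k < 4" for i j k
      using Re_triple_lim[of i j k] that unfolding N h4 by simp
    have f1_eq: "f1 m = - (Re (\<zeta> m 1 * \<zeta> m 2 * \<zeta> m 3) / (e m)\<^sup>2 + Re (\<zeta> m 0 * \<zeta> m 2 * \<zeta> m 3) / (e m)\<^sup>2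
        + Re (\<zeta> m 0 * \<zeta> m 1 * \<zeta> m 3) / (e m)\<^sup>2 + Re (\<zeta> m 0 * \<zeta> m 1 * \<zeta> m 2) / (e m)\<^sup>2)" for m
      unfolding f1_def F_def coeff_root_prod_4 uminus_complex.simps plus_complex.simps minus_divide_left
        add_divide_distrib[symmetric] ..
    have "(\<lambda>m. - (Re (\<zeta> m 1 * \<zeta> m 2 * \<zeta> m 3) / (e m)\<^sup>2 + Re (\<zeta> m 0 * \<zeta> m 2 * \<zeta> m 3) / (e m)\<^sup>2
        + Re (\<zeta> m 0 * \<zeta> m 1 * \<zeta> m 3) / (e m)\<^sup>2 + Re (\<zeta> m 0 * \<zeta> m 1 * \<zeta> m 2) / (e m)\<^sup>2))
      \<longlonglongrightarrow> - (- (\<xi> 1 * (\<eta> 2 * \<eta> 3) + \<xi> 2 * (\<eta> 1 * \<eta> 3) + \<xi> 3 * (\<eta> 1 * \<eta> 2))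
        + - (\<xi> 0 * (\<eta> 2 * \<eta> 3) + \<xi> 2 * (\<eta> 0 * \<eta> 3) + \<xi> 3 * (\<eta> 0 * \<eta> 2))
        + - (\<xi> 0 * (\<eta> 1 * \<eta> 3) + \<xi> 1 * (\<eta> 0 * \<eta> 3) + \<xi> 3 * (\<eta> 0 * \<eta> 1))
        + - (\<xi> 0 * (\<eta> 1 * \<eta> 2) + \<xi> 1 * (\<eta> 0 * \<eta> 2) + \<xi> 2 * (\<eta> 0 * \<eta> 1)))"
      by (intro tendsto_minus tendsto_add t) simp_all
    then have "f1 \<longlonglongrightarrow> - (- (\<xi> 1 * (\<eta> 2 * \<eta> 3) + \<xi> 2 * (\<eta> 1 * \<eta> 3) + \<xi> 3 * (\<eta> 1 * \<eta> 2))
        + - (\<xi> 0 * (\<eta> 2 * \<eta> 3) + \<xi> 2 * (\<eta> 0 * \<eta> 3) + \<xi> 3 * (\<eta> 0 * \<eta> 2))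
        + - (\<xi> 0 * (\<eta> 1 * \<eta> 3) + \<xi> 1 * (\<eta> 0 * \<eta> 3) + \<xi> 3 * (\<eta> 0 * \<eta> 1))
        + - (\<xi> 0 * (\<eta> 1 * \<eta> 2) + \<xi> 1 * (\<eta> 0 * \<eta> 2) + \<xi> 2 * (\<eta> 0 * \<eta> 1)))"
      unfolding f1_eq[symmetric] .
    then show ?thesis unfolding f_def by (simp add: algebra_simps)
  qed
  have F0_lim: "(\<lambda>m. F m 0 / of_real ((e m)\<^sup>2)) \<longlonglongrightarrow> of_real E"
  proof -
    have "coeff (root_prod 4 (\<lambda>k. \<i> * of_real (\<eta> k))) 0 = of_real E"
      unfolding coeff_root_prod_4 E_def by (simp add: algebra_simps)
    then show ?thesis using coeff_lim[of 0] unfolding N F_def by (simp flip: h4)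
  qed
  have f0_lim: "f0 \<longlonglongrightarrow> E"
    using tendsto_Re[OF F0_lim] unfolding f0_def Re_divide_of_real by simp
  have F_lim: "(\<lambda>m. F m i) \<longlonglongrightarrow> coeff (root_prod 4 (\<lambda>_. 0)) i" for i
    unfolding F_def using \<zeta>_lim unfolding N by (intro tendsto_coeff_root_prod)
  have M_lim: "M \<longlonglongrightarrow> 1"
  proof -
    have "M \<longlonglongrightarrow> of_real 1 ^ 4 + 5 / 4 * coeff (root_prod 4 (\<lambda>_. 0)) 3 * of_real 1 ^ 3 + 5 / 3 * coeff (root_prod 4 (\<lambda>_. 0)) 2 * of_real 1 ^ 2
      + 5 / 2 * coeff (root_prod 4 (\<lambda>_. 0)) 1 * of_real 1 + 5 * coeff (root_prod 4 (\<lambda>_. 0)) 0"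
      unfolding M_def by (intro tendsto_intros F_lim \<beta>_lim)
    then show ?thesis unfolding coeff_root_prod_4 by simp
  qed
  have T_lim: "T \<longlonglongrightarrow> E"
  proof -
    have "(\<lambda>m. Re (F m 0 / of_real ((e m)\<^sup>2) / (of_real (\<beta> m) * M m))) \<longlonglongrightarrow> Re (of_real E / (of_real 1 * 1))"
      by (intro tendsto_intros F0_lim \<beta>_lim M_lim) simp
    moreover have "Re (F m 0 / of_real ((e m)\<^sup>2) / (of_real (\<beta> m) * M m)) = T m" for m
      unfolding T_def Re_divide_of_real[symmetric] by (simp add: mult.commute)
    ultimately show ?thesis by simp
  qed
  have Re_F3: "Re (F m 3) = e m * a' m" for m
    unfolding F_def coeff_root_prod_4 a'_def sum_lessThan_4 by (simp add: x_eq algebra_simps)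
  have b_eq: "b m = (\<Sum>k<4. Im (\<zeta> m k)) / e m" for m unfolding b_def N e_def ..
  have Re_F2: "Re (F m 2) = ((e m)\<^sup>2 * (a' m)\<^sup>2 - (e m)\<^sup>2 * (b m)\<^sup>2 - (e m)\<^sup>2 * X' m + e m * S' m) / 2" for m
  proof -
    have "e m * b m = h m * (\<Sum>k<4. y m k)"
      unfolding b_eq y_eq sum_distrib_left using e(1)[of m] by simp
    then have "(e m)\<^sup>2 * (b m)\<^sup>2 = e m * (\<Sum>k<4. y m k)\<^sup>2"
      unfolding power_mult_distrib[symmetric] by (simp add: power_mult_distrib e_def)
    moreover have "h m * h m = e m" by (simp add: e_def power2_eq_square)
    then have hh: "h m * (h m * v) = e m * v" for v by (metis mult.assoc)
    ultimately show ?thesis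
      unfolding F_def coeff_root_prod_4 a'_def X'_def S'_def sum_lessThan_4
      by (simp add: x_eq y_eq power2_eq_square field_simps hh)
  qed
  have Re_M: "Re (M m) = \<beta> m ^ 4 + 5 / 4 * (e m * a' m) * \<beta> m ^ 3
      + 5 / 3 * (((e m)\<^sup>2 * (a' m)\<^sup>2 - (e m)\<^sup>2 * (b m)\<^sup>2 - (e m)\<^sup>2 * X' m + e m * S' m) / 2) * (\<beta> m)\<^sup>2
      + 5 / 2 * ((e m)\<^sup>2 * f1 m) * \<beta> m + 5 * ((e m)\<^sup>2 * f0 m)" for m
  proof -
    have "Re (of_real c * v * of_real d) = c * Re v * d" for c d v by simp
    note pull = this
    have "M m = of_real (\<beta> m ^ 4) + of_real (5 / 4) * F m 3 * of_real (\<beta> m ^ 3) + of_real (5 / 3) * F m 2 * of_real ((\<beta> m)\<^sup>2)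
      + of_real (5 / 2) * F m 1 * of_real (\<beta> m) + of_real 5 * F m 0 * of_real 1"
      by (simp add: M_def)
    then have "Re (M m) = \<beta> m ^ 4 + 5 / 4 * Re (F m 3) * \<beta> m ^ 3 + 5 / 3 * Re (F m 2) * (\<beta> m)\<^sup>2
      + 5 / 2 * Re (F m 1) * \<beta> m + 5 * Re (F m 0) * 1"
      by (simp only: plus_complex.simps pull Re_complex_of_real)
    moreover have "Re (F m 1) = (e m)\<^sup>2 * f1 m" "Re (F m 0) = (e m)\<^sup>2 * f0 m"
      using e(1)[of m] by (simp_all add: f1_def f0_def)
    ultimately show ?thesis unfolding Re_F2 Re_F3 by simp
  qed
  have M'_lim: "M' \<longlonglongrightarrow> 0"
  proof -
    have M'_eq: "M' m = - ((1 - \<beta> m ^ 4) / (h m)\<^sup>2) + 5 / 4 * a' m * \<beta> m ^ 3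
      + 5 / 3 * ((e m * (a' m)\<^sup>2 - e m * (b m)\<^sup>2 - e m * X' m + S' m) / 2) * (\<beta> m)\<^sup>2
      + 5 / 2 * (e m * f1 m) * \<beta> m + 5 * (e m * f0 m)" for m
      unfolding M'_def Re_M e_def[symmetric] using e(1)[of m] by (simp add: field_simps power2_eq_square)
    have "(\<lambda>m. - ((1 - \<beta> m ^ 4) / (h m)\<^sup>2) + 5 / 4 * a' m * \<beta> m ^ 3
      + 5 / 3 * ((e m * (a' m)\<^sup>2 - e m * (b m)\<^sup>2 - e m * X' m + S' m) / 2) * (\<beta> m)\<^sup>2
      + 5 / 2 * (e m * f1 m) * \<beta> m + 5 * (e m * f0 m))
      \<longlonglongrightarrow> - real 4 + 5 / 4 * (8 / 5) * 1 ^ 3 + 5 / 3 * ((0 * (8 / 5)\<^sup>2 - 0 * B\<^sup>2 - 0 * X + 12 / 5) / 2) * 1\<^sup>2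
        + 5 / 2 * (0 * f) * 1 + 5 * (0 * E)"
      by (intro tendsto_intros one_minus_power_lim a'_lim \<beta>_lim e_lim bB X'_lim S'_lim f1_lim f0_lim) simp_all
    then have "M' \<longlonglongrightarrow> - real 4 + 5 / 4 * (8 / 5) * 1 ^ 3 + 5 / 3 * ((0 * (8 / 5)\<^sup>2 - 0 * B\<^sup>2 - 0 * X + 12 / 5) / 2) * 1\<^sup>2
        + 5 / 2 * (0 * f) * 1 + 5 * (0 * E)"
      unfolding M'_eq[symmetric] .
    then show ?thesis by simp
  qed
  have a_ge: "4 * ((1 - 3 / 10 * \<beta> m * e m)\<^sup>2 - (\<beta> m)\<^sup>2) - (e m)\<^sup>2 * X' m - e m * S' m \<le> 2 * \<beta> m * (e m * a' m)" for m
  proof -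
    have each: "(1 - 3 / 10 * \<beta> m * e m)\<^sup>2 - (\<beta> m)\<^sup>2 - (e m)\<^sup>2 * (x m k)\<^sup>2 - e m * (y m k)\<^sup>2 \<le> - (2 * \<beta> m * (e m * x m k))"
      if "k < 4" for k
    proof -
      have em: "1 - \<beta> m = e m" using e(2)[of m] by simp
      have "1 - 3 / 10 * \<beta> m * e m < cmod (\<zeta> m k - of_real (\<beta> m))"
        using far[of m] that unfolding far_critical_def N em by blast
      moreover have "0 \<le> 1 - 3 / 10 * \<beta> m * e m" using radius_bounds[of "\<beta> m"] \<beta>[of m] unfolding em by simp
      ultimately have "(1 - 3 / 10 * \<beta> m * e m)\<^sup>2 \<le> (cmod (\<zeta> m k - of_real (\<beta> m)))\<^sup>2" by (intro power_mono) auto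
      also have "\<dots> = (e m * x m k - \<beta> m)\<^sup>2 + (h m * y m k)\<^sup>2"
        unfolding cmod_power2 by (simp add: x_eq y_eq)
      also have "\<dots> = (e m)\<^sup>2 * (x m k)\<^sup>2 - 2 * \<beta> m * (e m * x m k) + (\<beta> m)\<^sup>2 + e m * (y m k)\<^sup>2"
        by (simp add: e_def power_mult_distrib power2_diff)
      finally show ?thesis by simp
    qed
    have "(\<Sum>k<4. (1 - 3 / 10 * \<beta> m * e m)\<^sup>2 - (\<beta> m)\<^sup>2 - (e m)\<^sup>2 * (x m k)\<^sup>2 - e m * (y m k)\<^sup>2)
        \<le> (\<Sum>k<4. - (2 * \<beta> m * (e m * x m k)))"
      by (intro sum_mono each) simp
    then show ?thesis unfolding a'_def X'_def S'_def sum_subtractf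
      by (simp add: sum_distrib_left sum_negf mult.assoc)
  qed
  have "eventually (\<lambda>m. 1 / 2 < Re (M m)) sequentially" "eventually (\<lambda>m. 0 < \<beta> m) sequentially"
    using order_tendstoD(1)[OF tendsto_Re[OF M_lim], of "1 / 2"] order_tendstoD(1)[OF \<beta>_lim, of 0] by simp_all
  then have ev: "eventually (\<lambda>m. (- 18 / 5 + 267 / 40 * e m + 99 / 40 * e m ^ 2 - 27 / 4 * e m ^ 3 + 27 / 8 * e m ^ 4 - 27 / 40 * e m ^ 5) / \<beta> m
    - 5 / 8 * S' m * (1 + \<beta> m + (\<beta> m)\<^sup>2) / \<beta> m - X' m * (5 / 8 * (3 * \<beta> m ^ 3 + 1) / \<beta> m + 5 / 2 * (\<beta> m)\<^sup>2)
    + 5 / 2 * (\<beta> m)\<^sup>2 * ((a' m)\<^sup>2 - (b m)\<^sup>2) + 15 / 2 * \<beta> m * f1 m + 15 * f0 m + 5 * T m - 3 * (M' m)\<^sup>2 / Re (M m) \<le> 0) sequentially"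
  proof eventually_elim
    case (elim m)
    show ?case
    proof (rule quintic_expansion[OF e(1) _ e(2) a_ge Re_M])
      show "e m < 1" using elim(2) e(2)[of m] by simp
      show "Re (M m) - 1 = e m * M' m" using e(1)[of m] by (simp add: M'_def)
      have "far_critical 4 (\<beta> m) (z m) (\<zeta> m)" using far[of m] unfolding N .
      from quintic_log_inequality[OF this elim(2)] elim(1)
      have "3 * ((Re (M m) - 1) - (Re (M m) - 1)\<^sup>2 / Re (M m)) + 5 * Re (F m 0 / (of_real (\<beta> m) * M m)) - 1 / \<beta> m + \<beta> m + 5 / 4 * Re (F m 3) \<le> 0"
        unfolding M_def F_def by simp
      moreover have "Re (F m 0 / (of_real (\<beta> m) * M m)) = (e m)\<^sup>2 * T m"
        using e(1)[of m] by (simp add: T_def)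
      ultimately show "3 * ((Re (M m) - 1) - (Re (M m) - 1)\<^sup>2 / Re (M m)) + 5 * ((e m)\<^sup>2 * T m) - 1 / \<beta> m + \<beta> m + 5 / 4 * (e m * a' m) \<le> 0"
        unfolding Re_F3 by simp
    qed
  qed
  have "(\<lambda>m. (- 18 / 5 + 267 / 40 * e m + 99 / 40 * e m ^ 2 - 27 / 4 * e m ^ 3 + 27 / 8 * e m ^ 4 - 27 / 40 * e m ^ 5) / \<beta> m
    - 5 / 8 * S' m * (1 + \<beta> m + (\<beta> m)\<^sup>2) / \<beta> m - X' m * (5 / 8 * (3 * \<beta> m ^ 3 + 1) / \<beta> m + 5 / 2 * (\<beta> m)\<^sup>2)
    + 5 / 2 * (\<beta> m)\<^sup>2 * ((a' m)\<^sup>2 - (b m)\<^sup>2) + 15 / 2 * \<beta> m * f1 m + 15 * f0 m + 5 * T m - 3 * (M' m)\<^sup>2 / Re (M m))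
    \<longlonglongrightarrow> (- 18 / 5 + 267 / 40 * 0 + 99 / 40 * 0 ^ 2 - 27 / 4 * 0 ^ 3 + 27 / 8 * 0 ^ 4 - 27 / 40 * 0 ^ 5) / 1
    - 5 / 8 * (12 / 5) * (1 + 1 + 1\<^sup>2) / 1 - X * (5 / 8 * (3 * 1 ^ 3 + 1) / 1 + 5 / 2 * 1\<^sup>2)
    + 5 / 2 * 1\<^sup>2 * ((8 / 5)\<^sup>2 - B\<^sup>2) + 15 / 2 * 1 * f + 15 * E + 5 * E - 3 * 0\<^sup>2 / Re 1"
    by (intro tendsto_intros e_lim \<beta>_lim S'_lim X'_lim a'_lim bB f1_lim f0_lim T_lim M'_lim M_lim) simp_all
  from tendsto_upperbound[OF this ev] have "- 18 / 5 - 9 / 2 - 5 * X + 32 / 5 + 15 / 2 * f + 20 * E \<le> 0"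
    by (simp add: rigid(2) power2_eq_square)
  then show False using positive by linarith
qed

end

section \<open>Extraction of a convergent sequence and conclusion\<close>

lemma bounded_family_convergent_subseq:
  fixes f :: "nat \<Rightarrow> nat \<Rightarrow> real"
  assumes "\<And>k m. k < K \<Longrightarrow> \<bar>f k m\<bar> \<le> C"
  shows "\<exists>\<phi> l. strict_mono \<phi> \<and> (\<forall>k<K. (\<lambda>m. f k (\<phi> m)) \<longlonglongrightarrow> l k)"
  using assms
proof (induction K)
  case 0
  show ?case by (intro exI[of _ "\<lambda>m. m"]) (simp add: strict_mono_def)
next
  case (Suc K)
  then obtain \<phi> l where \<phi>: "strict_mono \<phi>" "\<And>k. k < K \<Longrightarrow> (\<lambda>m. f k (\<phi> m)) \<longlonglongrightarrow> l k"
    by (metis less_SucI)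
  have "bounded (range (\<lambda>m. f K (\<phi> m)))"
    unfolding bounded_iff using Suc.prems[of K] by auto
  then obtain c \<psi> where \<psi>: "strict_mono \<psi>" "((\<lambda>m. f K (\<phi> m)) \<circ> \<psi>) \<longlonglongrightarrow> c"
    using bounded_imp_convergent_subsequence by blast
  show ?case
  proof (intro exI conjI allI impI)
    show "strict_mono (\<phi> \<circ> \<psi>)" using \<phi>(1) \<psi>(1) by (rule strict_mono_o)
    fix k assume "k < Suc K"
    then consider "k < K" | "k = K" by linarith
    then show "(\<lambda>m. f k ((\<phi> \<circ> \<psi>) m)) \<longlonglongrightarrow> (l(K := c)) k"
    proof cases
      case 1
      then show ?thesis using LIMSEQ_subseq_LIMSEQ[OF \<phi>(2)[OF 1] \<psi>(1)] by (simp add: o_def)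
    next
      case 2
      then show ?thesis using \<psi>(2) by (simp add: o_def)
    qed
  qed
qed

text \<open>
  Two extractions are necessary: boundedness of \<open>b\<close> is available only once the rescaled critical
  points converge.
\<close>

lemma no_far_critical_sequence:
  assumes far: "\<And>m. far_critical (Suc (Suc p)) (\<beta> m) (z m) (\<zeta> m)"
    and \<beta>: "\<And>m. 0 \<le> \<beta> m" "\<And>m. \<beta> m < 1" "\<beta> \<longlonglongrightarrow> 1"
    and small: "\<And>m k. k < Suc (Suc p) \<Longrightarrow> \<bar>Re (\<zeta> m k)\<bar> \<le> C * (1 - \<beta> m)"
      "\<And>m k. k < Suc (Suc p) \<Longrightarrow> (Im (\<zeta> m k))\<^sup>2 \<le> C * (1 - \<beta> m)"
  shows False
proof -
  let ?N = "Suc (Suc p)"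
  define g where "g k m = (if k < ?N then Re (\<zeta> m k) / (1 - \<beta> m) else Im (\<zeta> m (k - ?N)) / sqrt (1 - \<beta> m))" for k m
  have "\<bar>g k m\<bar> \<le> max C (sqrt C)" if "k < 2 * ?N" for k m
  proof (cases "k < ?N")
    case True
    then have "\<bar>g k m\<bar> \<le> C" using small(1)[OF True, of m] \<beta>(2)[of m]
      by (simp add: g_def abs_divide divide_le_eq)
    then show ?thesis by simp
  next
    case False
    then have k: "k - ?N < ?N" using that by simp
    have "\<bar>Im (\<zeta> m (k - ?N))\<bar> \<le> sqrt (C * (1 - \<beta> m))"
      using real_le_rsqrt[of "\<bar>Im (\<zeta> m (k - ?N))\<bar>"] small(2)[OF k, of m] by simp
    also have "\<dots> = sqrt C * sqrt (1 - \<beta> m)" by (rule real_sqrt_mult)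
    finally have "\<bar>g k m\<bar> \<le> sqrt C" using False \<beta>(2)[of m]
      by (simp add: g_def abs_divide divide_le_eq)
    then show ?thesis by simp
  qed
  then obtain \<phi> l where \<phi>: "strict_mono \<phi>" "\<And>k. k < 2 * ?N \<Longrightarrow> (\<lambda>m. g k (\<phi> m)) \<longlonglongrightarrow> l k"
    using bounded_family_convergent_subseq[of "2 * ?N" g] by blast
  define \<xi> \<eta> where "\<xi> = l" and "\<eta> k = l (?N + k)" for k
  have Re: "(\<lambda>m. Re (\<zeta> (\<phi> m) k) / (1 - \<beta> (\<phi> m))) \<longlonglongrightarrow> \<xi> k" if "k < ?N" for k
    using \<phi>(2)[of k] that by (simp add: g_def \<xi>_def)
  have Im: "(\<lambda>m. Im (\<zeta> (\<phi> m) k) / sqrt (1 - \<beta> (\<phi> m))) \<longlonglongrightarrow> \<eta> k" if "k < ?N" for k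
    using \<phi>(2)[of "?N + k"] that by (simp add: g_def \<eta>_def)
  have sub: "far_critical_limit p (\<lambda>m. \<beta> (\<phi> (\<psi> m))) (\<lambda>m. z (\<phi> (\<psi> m))) (\<lambda>m. \<zeta> (\<phi> (\<psi> m))) \<xi> \<eta>"
    if \<psi>: "strict_mono \<psi>" for \<psi>
  proof
    show "(\<lambda>m. \<beta> (\<phi> (\<psi> m))) \<longlonglongrightarrow> 1"
      using LIMSEQ_subseq_LIMSEQ[OF \<beta>(3) strict_mono_o[OF \<phi>(1) \<psi>]] by (simp add: o_def)
    fix k assume k: "k < ?N"
    show "(\<lambda>m. Re (\<zeta> (\<phi> (\<psi> m)) k) / (1 - \<beta> (\<phi> (\<psi> m)))) \<longlonglongrightarrow> \<xi> k"
      using LIMSEQ_subseq_LIMSEQ[OF Re[OF k] \<psi>] by (simp add: o_def)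
    show "(\<lambda>m. Im (\<zeta> (\<phi> (\<psi> m)) k) / sqrt (1 - \<beta> (\<phi> (\<psi> m)))) \<longlonglongrightarrow> \<eta> k"
      using LIMSEQ_subseq_LIMSEQ[OF Im[OF k] \<psi>] by (simp add: o_def)
  qed (use far \<beta> in auto)
  interpret A: far_critical_limit p "\<lambda>m. \<beta> (\<phi> m)" "\<lambda>m. z (\<phi> m)" "\<lambda>m. \<zeta> (\<phi> m)" \<xi> \<eta>
    using sub[of "\<lambda>m. m"] by (simp add: strict_mono_def)
  have "bounded (range A.b)" using A.b_bounded by (simp add: Bseq_eq_bounded)
  then obtain B \<psi> where \<psi>: "strict_mono \<psi>" "(A.b \<circ> \<psi>) \<longlonglongrightarrow> B"
    using bounded_imp_convergent_subsequence by blast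
  interpret L: far_critical_limit p "\<lambda>m. \<beta> (\<phi> (\<psi> m))" "\<lambda>m. z (\<phi> (\<psi> m))" "\<lambda>m. \<zeta> (\<phi> (\<psi> m))" \<xi> \<eta>
    by (rule sub[OF \<psi>(1)])
  have "L.b = A.b \<circ> \<psi>"
    by (rule ext) (simp add: L.b_def A.b_def L.h_def A.h_def)
  then have "L.b \<longlonglongrightarrow> B" using \<psi>(2) by simp
  then show False using L.degree_5 L.not_quintic by blast
qed

text \<open>
  If no \<open>\<delta>\<close> works, there are violations with \<open>\<beta>\<close> arbitrarily close to 1. The value \<open>\<beta> = 1\<close> and degree 2
  are excluded directly, since the rescaling needs \<open>\<beta> < 1\<close> and the first order analysis needs a root
  of unity that is not real.
\<close>

theorem theorem6:
  fixes n :: nat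
  assumes "n \<ge> 2"
  shows "\<exists>\<delta>>0. \<forall>\<beta>\<in>{0..1::real}. 1 - \<beta> < \<delta> \<longrightarrow>
    sendov_r n \<beta> \<le> 1 - 3 / 10 * \<beta> * (1 - \<beta>)"
proof (rule ccontr)
  assume neg: "\<not> ?thesis"
  have "0 < n - 1" using assms by simp
  from far_critical_points_small[OF this] obtain C where "\<exists>\<delta>>0. \<forall>\<beta> z \<zeta>. far_critical (n - 1) \<beta> z \<zeta> \<longrightarrow>
      1 - \<delta> \<le> \<beta> \<longrightarrow> \<beta> \<le> 1 \<longrightarrow> (\<forall>k<n - 1. \<bar>Re (\<zeta> k)\<bar> \<le> C * (1 - \<beta>) \<and> (Im (\<zeta> k))\<^sup>2 \<le> C * (1 - \<beta>))"
    by blast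
  then obtain \<delta> where C: "0 < \<delta>" "\<And>\<beta> z \<zeta> k. far_critical (n - 1) \<beta> z \<zeta> \<Longrightarrow> 1 - \<delta> \<le> \<beta> \<Longrightarrow> \<beta> \<le> 1 \<Longrightarrow> k < n - 1 \<Longrightarrow>
      \<bar>Re (\<zeta> k)\<bar> \<le> C * (1 - \<beta>) \<and> (Im (\<zeta> k))\<^sup>2 \<le> C * (1 - \<beta>)"
    by blast
  have "\<exists>\<beta> z \<zeta>. \<beta> \<in> {0..1} \<and> 1 - \<beta> < min \<delta> (inverse (real (Suc m))) \<and> far_critical (n - 1) \<beta> z \<zeta>" for m
  proof -
    have "0 < min \<delta> (inverse (real (Suc m)))" using C(1) by simp
    with neg obtain \<beta> where "\<beta> \<in> {0..1}" "1 - \<beta> < min \<delta> (inverse (real (Suc m)))"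
      "\<not> sendov_r n \<beta> \<le> 1 - 3 / 10 * \<beta> * (1 - \<beta>)" by blast
    with far_critical_exists[OF assms] show ?thesis by blast
  qed
  then obtain \<beta> z \<zeta> where *: "\<And>m. \<beta> m \<in> {0..1}" "\<And>m. 1 - \<beta> m < min \<delta> (inverse (real (Suc m)))"
    "\<And>m. far_critical (n - 1) (\<beta> m) (z m) (\<zeta> m)" by metis
  have \<beta>_lim: "\<beta> \<longlonglongrightarrow> 1"
  proof -
    have "(\<lambda>m. \<beta> m - 1) \<longlonglongrightarrow> 0"
    proof (rule Lim_null_comparison[OF _ LIMSEQ_inverse_real_of_nat], rule always_eventually, rule allI)
      show "norm (\<beta> m - 1) \<le> inverse (real (Suc m))" for m using *(1,2)[of m] by simp
    qed
    then show ?thesis by (simp add: LIM_zero_iff)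
  qed
  have "\<beta> m \<noteq> 1" for m using no_far_critical_at_1[of "n - 1"] *(3)[of m] assms by auto
  then have \<beta>1: "\<beta> m < 1" for m using *(1)[of m] by (simp add: less_le)
  show False
  proof (cases "n = 2")
    case True
    then show False using no_far_critical_quadratic[of "\<beta> 0"] *(1,3)[of 0] by simp
  next
    case False
    then have n: "n - 1 = Suc (Suc (n - 3))" using assms by simp
    have small: "\<bar>Re (\<zeta> m k)\<bar> \<le> C * (1 - \<beta> m) \<and> (Im (\<zeta> m k))\<^sup>2 \<le> C * (1 - \<beta> m)" if "k < Suc (Suc (n - 3))" for m k
      using C(2)[OF *(3)[of m], of k] *(1,2)[of m] that n by simp
    show False
      by (rule no_far_critical_sequence[of "n - 3" \<beta> z \<zeta> C])
        (use *(1,3) \<beta>1 \<beta>_lim small in \<open>auto simp flip: n\<close>)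
  qed
qed

end
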